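(* Let $(R,\mathfrak m,k)$ be a Noetherian, analytically unramified, residually rational, one-dimensional, local reduced ring with two minimal primes, with value semigroup $S=v(R)\subseteq\mathbb N^2$ (so that $R/(x)$ below is regarded as a $k$-vector space via a field $k\subseteq R$ mapping isomorphically onto $R/\mathfrak m$). Let $x\in R$ be such that $v(x)=\boldsymbol e=\min(S\setminus\{\boldsymbol 0\})$, and let $\mathrm{Ap}(S)=\bigcup_{i=1}^e A_i$ be the partition of the Apéry set of $S$ into levels. Then there exists a chain $$\alpha^{(1)}<\alpha^{(2)}<\cdots<\alpha^{(e)}$$ of elements of $S$ with $\alpha^{(i)}\in A_i$ for every $i$, such that for every collection of elements $f_1,\dots,f_e\in R$ with $v(f_i)=\alpha^{(i)}$ for all $i$, $$R/(x)=\langle\overline{f_1},\overline{f_2},\dots,\overline{f_e}\rangle_k .$$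
   Context: Ring setting: the integral closure $\overline R$ of $R$ in its total ring of fractions is a product $V_1\times V_2$ of two discrete valuation rings with valuations $v_1,v_2$, finite over $R$; residually rational means that the residue fields of $\overline R$ at its maximal ideals coincide with $k=R/\mathfrak m$. For a nonzerodivisor $f$, $v(f)=(v_1(f),v_2(f))$, and $v(R)=\{v(f):f\in R\text{ a nonzerodivisor}\}\subseteq\mathbb N^2$. Under these hypotheses $S=v(R)$ is a local good semigroup as defined next. $\overline f$ denotes the class of $f$ in $R/(x)$, and $\langle\cdots\rangle_k$ the $k$-linear span. On $\mathbb Z^2$, $\alpha\le\beta$ is the componentwise order ($\alpha<\beta$ means $\alpha\le\beta$, $\alpha\ne\beta$); $\alpha\wedge\beta$ is the componentwise minimum; $\alpha\ll\beta$ means $\alpha_1<\beta_1$ and $\alpha_2<\beta_2$; $\alpha\le\le\beta$ means $\alpha=\beta$ or $\alpha\ll\beta$. A good semigroup is a submonoid $S$ of $(\mathbb N^2,+)$ such that: (G1) $\alpha,\beta\in S\Rightarrow\alpha\wedge\beta\in S$; (G2) if $\alpha,\beta\in S$ and $\alpha_i=\beta_i$ for some $i\in\{1,2\}$, where $j$ is the other index, then there is $\delta\in S$ with $\delta_i>\alpha_i=\beta_i$, $\delta_j\ge\min\{\alpha_j,\beta_j\}$, and $\delta_j=\min\{\alpha_j,\beta_j\}$ if $\alpha_j\neq\beta_j$; (G3) there is $c\in S$ with $c+\mathbb N^2\subseteq S$. Local means $(0,0)$ is the only element with a zero component. $\boldsymbol e=(e_1,e_2)$ is the minimum of $S\setminus\{(0,0)\}$,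 and $\mathrm{Ap}(S)=\{\alpha\in S:\alpha-\boldsymbol e\notin S\}$. Levels: for $i\ge1$, having defined $D^{(1)},\dots,D^{(i-1)}$, let $B^{(i)}$ be the set of elements of $\mathrm{Ap}(S)\setminus\bigcup_{j<i}D^{(j)}$ maximal in it with respect to $\le\le$, let $C^{(i)}=\{\alpha\in B^{(i)}:\alpha=\beta_1\wedge\beta_2\text{ for some }\beta_1,\beta_2\in B^{(i)}\setminus\{\alpha\}\}$, and $D^{(i)}=B^{(i)}\setminus C^{(i)}$. For some least $N$, $\mathrm{Ap}(S)$ is the disjoint union of $D^{(1)},\dots,D^{(N)}$, and $A_i=D^{(N+1-i)}$. It is a fact that $N=e_1+e_2$; this number is denoted $e$. *)

theory Defs
  imports
    "HOL-Library.Product_Order"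
    "HOL-Library.Extended_Nat"
    "HOL-Algebra.Algebra"
begin

section \<open>Commutative algebra\<close>

definition reduced_ring :: "('a, 'm) ring_scheme \<Rightarrow> bool" where
  "reduced_ring R \<longleftrightarrow>
     cring R \<and> (\<forall>a\<in>carrier R. \<forall>n::nat. a [^]\<^bsub>R\<^esub> n = \<zero>\<^bsub>R\<^esub> \<longrightarrow> a = \<zero>\<^bsub>R\<^esub>)"

definition minimal_prime :: "'a set \<Rightarrow> ('a, 'm) ring_scheme \<Rightarrow> bool" where
  "minimal_prime P R \<longleftrightarrow> primeideal P R \<and> (\<forall>P'. primeideal P' R \<and> P' \<subseteq> P \<longrightarrow> P' = P)"

definition krull_dim :: "('a, 'm) ring_scheme \<Rightarrow> enat" where
  "krull_dim R =
     Sup {enat n | n. \<exists>P :: nat \<Rightarrow> 'a set.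
            (\<forall>i\<le>n. primeideal (P i) R) \<and> (\<forall>i<n. P i \<subset> P (Suc i))}"

text \<open>
  The \<open>I\<close>-adic completion is the inverse limit of the quotients by the powers of \<open>I\<close>, realised as
  coherent sequences of cosets.  Powers of an ideal are taken in the multiplicative monoid of
  \<^const>\<open>ideals_set\<close>, whose unit is the whole ring.  The condition \<open>s (Suc n) \<subseteq> s n\<close> says that
  the canonical projection maps the coset \<open>s (Suc n)\<close> to the coset \<open>s n\<close>.
\<close>

definition adic_completion :: "('a, 'm) ring_scheme \<Rightarrow> 'a set \<Rightarrow> (nat \<Rightarrow> 'a set) ring" where
  "adic_completion R I =
     (let Q = (\<lambda>n::nat. R Quot (I [^]\<^bsub>ideals_set R\<^esub> n)) in
      \<lparr> carrier = {s. (\<forall>n. s n \<in> carrier (Q n)) \<and> (\<forall>n. s (Suc n) \<subseteq> s n)},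
        monoid.mult = (\<lambda>s t n. s n \<otimes>\<^bsub>Q n\<^esub> t n),
        one = (\<lambda>n. \<one>\<^bsub>Q n\<^esub>),
        ring.zero = (\<lambda>n. \<zero>\<^bsub>Q n\<^esub>),
        add = (\<lambda>s t n. s n \<oplus>\<^bsub>Q n\<^esub> t n) \<rparr>)"

definition analytically_unramified :: "('a, 'm) ring_scheme \<Rightarrow> 'a set \<Rightarrow> bool" where
  "analytically_unramified R m \<longleftrightarrow> reduced_ring (adic_completion R m)"

definition nonzerodivisors :: "('a, 'm) ring_scheme \<Rightarrow> 'a set" where
  "nonzerodivisors R =
     {f \<in> carrier R. \<forall>g\<in>carrier R. f \<otimes>\<^bsub>R\<^esub> g = \<zero>\<^bsub>R\<^esub> \<longrightarrow> g = \<zero>\<^bsub>R\<^esub>}"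

text \<open>The total ring of fractions is taken to contain \<open>R\<close> as a subring.\<close>

definition total_ring_of_fractions :: "'a ring \<Rightarrow> 'a ring \<Rightarrow> bool" where
  "total_ring_of_fractions Q R \<longleftrightarrow>
     cring Q \<and> subcring (carrier R) Q \<and> R = Q\<lparr>carrier := carrier R\<rparr> \<and>
     nonzerodivisors R \<subseteq> Units Q \<and>
     carrier Q = {a \<otimes>\<^bsub>Q\<^esub> inv\<^bsub>Q\<^esub> b | a b. a \<in> carrier R \<and> b \<in> nonzerodivisors R}"

definition integral_closure :: "'a ring \<Rightarrow> 'a ring \<Rightarrow> 'a ring" where
  "integral_closure R Q = Q\<lparr>carrier :=
     {q \<in> carrier Q. \<exists>p. p \<noteq> [] \<and> polynomial\<^bsub>Q\<^esub> (carrier R) p \<and> lead_coeff p = \<one>\<^bsub>Q\<^esub>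
                         \<and> ring.eval Q p q = \<zero>\<^bsub>Q\<^esub>}\<rparr>"

text \<open>For a subring \<open>R\<close> of \<open>B\<close>.\<close>

definition finite_ring_extension :: "'a ring \<Rightarrow> 'a ring \<Rightarrow> bool" where
  "finite_ring_extension R B \<longleftrightarrow>
     (\<exists>bs. set bs \<subseteq> carrier B \<and> ring.Span B (carrier R) bs = carrier B)"

text \<open>
  For an integral extension \<open>B\<close> of the local ring \<open>R\<close>, every maximal ideal \<open>n\<close> of \<open>B\<close> lies over the
  maximal ideal of \<open>R\<close>, so the residue field of \<open>R\<close> embeds into \<open>B Quot n\<close>, with image the
  image of \<open>R\<close>.
\<close>

definition residually_rational :: "'a ring \<Rightarrow> 'a ring \<Rightarrow> bool" where
  "residually_rational R B \<longleftrightarrow>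
     (\<forall>n. maximalideal n B \<longrightarrow> (\<lambda>a. n +>\<^bsub>B\<^esub> a) ` carrier R = carrier (B Quot n))"

definition discrete_valuation_ring :: "('a, 'm) ring_scheme \<Rightarrow> bool" where
  "discrete_valuation_ring V \<longleftrightarrow> principal_domain V \<and> \<not> field V \<and> (\<exists>!M. maximalideal M V)"

text \<open>Only meaningful at nonzero elements.\<close>

definition dvr_val :: "('a, 'm) ring_scheme \<Rightarrow> 'a \<Rightarrow> nat" where
  "dvr_val V f =
     (THE n. \<exists>t\<in>carrier V. \<exists>u\<in>Units V.
        maximalideal (PIdl\<^bsub>V\<^esub> t) V \<and> f = u \<otimes>\<^bsub>V\<^esub> t [^]\<^bsub>V\<^esub> n)"

text \<open>
  Here \<open>\<phi>\<close> identifies the integral closure of \<open>R\<close> with the product of the discrete valuation rings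
  \<open>V1\<close> and \<open>V2\<close>.
\<close>

definition value_vec ::
  "('a \<Rightarrow> 'b \<times> 'c) \<Rightarrow> 'b ring \<Rightarrow> 'c ring \<Rightarrow> 'a \<Rightarrow> nat \<times> nat" where
  "value_vec \<phi> V1 V2 f = (dvr_val V1 (fst (\<phi> f)), dvr_val V2 (snd (\<phi> f)))"

definition value_semigroup ::
  "'a ring \<Rightarrow> ('a \<Rightarrow> 'b \<times> 'c) \<Rightarrow> 'b ring \<Rightarrow> 'c ring \<Rightarrow> (nat \<times> nat) set" where
  "value_semigroup R \<phi> V1 V2 = value_vec \<phi> V1 V2 ` nonzerodivisors R"


section \<open>Subsemigroups of the plane\<close>

text \<open>
  Pairs carry the componentwise order and addition, so that \<open>inf\<close> is the componentwise minimum.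
\<close>

definition min_vec :: "(nat \<times> nat) set \<Rightarrow> nat \<times> nat" where
  "min_vec S = (LEAST \<alpha>. \<alpha> \<in> S - {0})"

text \<open>
  The condition \<open>\<alpha> - e \<notin> S\<close> refers to the difference in the integer plane; since
  subtraction on \<^typ>\<open>nat\<close> truncates, it is written additively.
\<close>

definition apery_set :: "(nat \<times> nat) set \<Rightarrow> (nat \<times> nat) set" where
  "apery_set S = {\<alpha> \<in> S. \<not> (\<exists>\<sigma>\<in>S. \<alpha> = \<sigma> + min_vec S)}"

definition lele :: "nat \<times> nat \<Rightarrow> nat \<times> nat \<Rightarrow> bool" where
  "lele \<alpha> \<beta> \<longleftrightarrow> \<alpha> = \<beta> \<or> (fst \<alpha> < fst \<beta> \<and> snd \<alpha> < snd \<beta>)"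

definition lele_maximal :: "(nat \<times> nat) set \<Rightarrow> (nat \<times> nat) set" where
  "lele_maximal A = {\<alpha> \<in> A. \<forall>\<beta>\<in>A. lele \<alpha> \<beta> \<longrightarrow> \<beta> = \<alpha>}"

definition proper_infima :: "(nat \<times> nat) set \<Rightarrow> (nat \<times> nat) set" where
  "proper_infima B = {\<alpha> \<in> B. \<exists>\<beta>1\<in>B - {\<alpha>}. \<exists>\<beta>2\<in>B - {\<alpha>}. \<alpha> = inf \<beta>1 \<beta>2}"

text \<open>The sets \<open>D\<close>, indexed from 1.\<close>

fun apery_D :: "(nat \<times> nat) set \<Rightarrow> nat \<Rightarrow> (nat \<times> nat) set" where
  "apery_D S i =
     (let B = lele_maximal (apery_set S - (\<Union>j\<in>{1..<i}. apery_D S j))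
      in B - proper_infima B)"

declare apery_D.simps [simp del]

definition apery_N :: "(nat \<times> nat) set \<Rightarrow> nat" where
  "apery_N S = (LEAST N. apery_set S = (\<Union>i\<in>{1..N}. apery_D S i))"

definition apery_level :: "(nat \<times> nat) set \<Rightarrow> nat \<Rightarrow> (nat \<times> nat) set" where
  "apery_level S i = apery_D S (apery_N S + 1 - i)"

end

(* Filter R/(x) by the images of R(a,b) = {f. v(f) >= (a,b)}. Along a path of unit steps in the
   plane the filtration drops by at most one in each step, and whether it drops is visible in S
   alone: R(a,b) must contain an element of first value a while xR does not contain one in that
   range (similarly for vertical steps). Hence the number d(a,b) of drops before (a,b) is a
   combinatorial function, independent of the path by the exchange properties of S, and equal to
   e1 + e2 far out. Downward through the levels one finds that an element alpha of Ap(S) lies in D^(i)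
   exactly when d(alpha) = e1 + e2 - i, so N = e1 + e2 and A_i = {alpha in Ap(S). d(alpha) = i - 1}.
   Every alpha in Ap(S) starts a drop in some direction; following that step and then walking on to
   the next drop gives a chain through all levels. Elements f_i with these values absorb the
   successive drops, so they span R/(x). *)

theory Submission
  imports Defs
begin

section \<open>Good subsets of the plane and the levels of the Apery set\<close>

text \<open>A drop is decided by a ray and not by a point: the step to the right out of
  \<open>(a, b)\<close> loses something iff some element has first value exactly \<open>a\<close>
  and second value at least \<open>b\<close>. That second value may be infinite, the element being a
  zero divisor, and then it gives no point of \<open>S\<close>; adding an element with values beyond
  the conductor repairs this. The multiples of \<open>x\<close> are counted by the same recipe on
  the translate of \<open>S\<close> by \<open>v(x)\<close>, so \<open>d\<close> is a difference of
  two counts, and e1 + e2 is the number of unit steps in the translation.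

  The sets C^(i) fit this count: if \<open>d\<close> grows by two across the unit square at an
  element of Ap(S), that element is the infimum of two elements one level up; if it grows by one,
  some element one level up is larger in both coordinates.

  The ring enters only through a short list of properties of two valuations: residues represented in
  \<open>k\<close>, and a conductor. The integral closure is at the outset a mere set of roots of
  monic polynomials; its ring structure is recovered from the bijection with the product of the two
  valuation rings.\<close>

definition ray_up :: "(nat \<times> nat) set \<Rightarrow> nat \<Rightarrow> nat \<Rightarrow> bool" where
  "ray_up T a b \<longleftrightarrow> (\<exists>y\<ge>b. (a, y) \<in> T)"

definition ray_right :: "(nat \<times> nat) set \<Rightarrow> nat \<Rightarrow> nat \<Rightarrow> bool" where
  "ray_right T a b \<longleftrightarrow> (\<exists>x\<ge>a. (x, b) \<in> T)"

text \<open>For \<open>T = S\<close> this is the length of \<open>R / R(a, b)\<close>, read off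
  along the axis and then up column \<open>a\<close>; for the translate of \<open>S\<close> by
  \<open>v(x)\<close> it is the length of \<open>xR / (xR \<inter> R(a, b))\<close>.\<close>

definition path_count :: "(nat \<times> nat) set \<Rightarrow> nat \<Rightarrow> nat \<Rightarrow> nat" where
  "path_count T a b =
     (\<Sum>x<a. of_bool (ray_up T x 0)) + (\<Sum>y<b. of_bool (ray_right T a y))"

text \<open>The conditions are (G1) and the case of (G2) in which the other coordinates differ. They
  are invariant under translation, so they pass from \<open>S\<close> to its shift.\<close>

locale good_set =
  fixes T :: "(nat \<times> nat) set"
  assumes inf_closed: "\<lbrakk>(a, b) \<in> T; (a', b') \<in> T\<rbrakk> \<Longrightarrow> (min a a', min b b') \<in> T"
    and exchange_right: "\<lbrakk>(a, b) \<in> T; (a, y) \<in> T; b < y\<rbrakk> \<Longrightarrow> \<exists>x>a. (x, b) \<in> T"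
    and exchange_up: "\<lbrakk>(a, b) \<in> T; (x, b) \<in> T; a < x\<rbrakk> \<Longrightarrow> \<exists>y>b. (a, y) \<in> T"
begin

text \<open>A point straight above \<open>(a, b)\<close> and one straight to its right have infimum
  \<open>(a, b)\<close>.\<close>

lemma corner: "ray_up T a b \<Longrightarrow> ray_right T a b \<Longrightarrow> (a, b) \<in> T"
  unfolding ray_up_def ray_right_def using inf_closed by (metis min.absorb1 min.absorb2)

text \<open>The two sides count the drops along the two ways around a unit square. If
  \<open>(a, b)\<close> is not in \<open>T\<close>, each ray from it may be shortened by one and the
  terms agree in pairs; if it is in \<open>T\<close>, both rays from it are occupied and the
  exchange properties make the two remaining terms equal.\<close>

lemma square:
  "of_bool (ray_up T a b) + of_bool (ray_right T (Suc a) b)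
   = (of_bool (ray_right T a b) + of_bool (ray_up T a (Suc b)) :: nat)"
proof -
  have up: "ray_up T a b \<longleftrightarrow> (a, b) \<in> T \<or> ray_up T a (Suc b)"
    unfolding ray_up_def by (metis Suc_leD Suc_leI le_eq_less_or_eq order_refl)
  have right: "ray_right T a b \<longleftrightarrow> (a, b) \<in> T \<or> ray_right T (Suc a) b"
    unfolding ray_right_def by (metis Suc_leD Suc_leI le_eq_less_or_eq order_refl)
  have "ray_right T (Suc a) b" if "(a, b) \<in> T" "ray_up T a (Suc b)"
    using exchange_right that unfolding ray_up_def ray_right_def by (meson Suc_le_eq)
  moreover have "ray_up T a (Suc b)" if "(a, b) \<in> T" "ray_right T (Suc a) b"
    using exchange_up that unfolding ray_up_def ray_right_def by (meson Suc_le_eq)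
  ultimately show ?thesis
    using up right corner[of a b] by (cases "(a, b) \<in> T") (auto split: if_splits)
qed

lemma path_count_up: "path_count T a (Suc b) = path_count T a b + of_bool (ray_right T a b)"
  by (simp add: path_count_def)

text \<open>This is path independence: the horizontal steps of \<open>path_count\<close> are taken
  at height 0, and \<open>square\<close> lifts such a step one row at a time.\<close>

lemma path_count_right: "path_count T (Suc a) b = path_count T a b + of_bool (ray_up T a b)"
proof (induction b)
  case 0
  then show ?case by (simp add: path_count_def)
next
  case (Suc b)
  then show ?case using square[of a b] by (simp add: path_count_up)
qed

end

section \<open>The translated set, jumps and the Apery set\<close>

text \<open>Here \<open>(p, q)\<close> is any vector whose translation preserves \<open>S\<close>;
  only the results on levels identify it with \<open>min_vec S\<close>.\<close>

locale apery_plane = good_set S for S :: "(nat \<times> nat) set" +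
  fixes p q c1 c2 :: nat
  assumes translate: "(a, b) \<in> S \<Longrightarrow> (a + p, b + q) \<in> S"
    and conductor: "\<lbrakk>c1 \<le> a; c2 \<le> b\<rbrakk> \<Longrightarrow> (a, b) \<in> S"
begin

definition E :: "(nat \<times> nat) set" where
  "E = {(a + p, b + q) | a b. (a, b) \<in> S}"

definition Ap :: "(nat \<times> nat) set" where
  "Ap = S - E"

definition jump_right :: "nat \<Rightarrow> nat \<Rightarrow> bool" where
  "jump_right a b \<longleftrightarrow> ray_up S a b \<and> \<not> ray_up E a b"

definition jump_up :: "nat \<Rightarrow> nat \<Rightarrow> bool" where
  "jump_up a b \<longleftrightarrow> ray_right S a b \<and> \<not> ray_right E a b"

text \<open>In the ring, \<open>d a b\<close> is the length of \<open>R / (xR + R(a, b))\<close>, where \<open>R(a, b)\<close> consists of the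
  elements of value at least \<open>(a, b)\<close>.\<close>

definition d :: "nat \<Rightarrow> nat \<Rightarrow> nat" where
  "d a b = path_count S a b - path_count E a b"

lemma E_subset: "E \<subseteq> S"
  using translate by (auto simp: E_def)

lemma E_iff: "(a, b) \<in> E \<longleftrightarrow> p \<le> a \<and> q \<le> b \<and> (a - p, b - q) \<in> S"
  unfolding E_def by (auto; metis le_add_diff_inverse2)

sublocale E: good_set E
proof
  fix a b a' b' assume "(a, b) \<in> E" "(a', b') \<in> E"
  moreover have "min a a' - p = min (a - p) (a' - p)" "min b b' - q = min (b - q) (b' - q)"
    by auto
  ultimately show "(min a a', min b b') \<in> E"
    using inf_closed by (auto simp: E_iff)
next
  fix a b y assume *: "(a, b) \<in> E" "(a, y) \<in> E" "b < y"
  then obtain x where "x > a - p" "(x, b - q) \<in> S"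
    using exchange_right[of "a - p" "b - q" "y - q"] by (auto simp: E_iff diff_less_mono)
  then show "\<exists>x>a. (x, b) \<in> E"
    using * by (intro exI[of _ "x + p"]) (auto simp: E_iff)
next
  fix a b x assume *: "(a, b) \<in> E" "(x, b) \<in> E" "a < x"
  then obtain y where "y > b - q" "(a - p, y) \<in> S"
    using exchange_up[of "a - p" "b - q" "x - p"] by (auto simp: E_iff diff_less_mono)
  then show "\<exists>y>b. (a, y) \<in> E"
    using * by (intro exI[of _ "y + q"]) (auto simp: E_iff)
qed

lemma ray_mono: "ray_up E a b \<Longrightarrow> ray_up S a b" "ray_right E a b \<Longrightarrow> ray_right S a b"
  using E_subset by (auto simp: ray_up_def ray_right_def)

text \<open>Makes the truncated subtraction in \<open>d\<close> an honest difference.\<close>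

lemma path_count_E_le: "path_count E a b \<le> path_count S a b"
  unfolding path_count_def by (intro add_mono sum_mono) (auto dest: ray_mono)

lemma d_right: "d (Suc a) b = d a b + of_bool (jump_right a b)"
  using path_count_E_le[of a b] ray_mono
  by (auto simp: d_def jump_right_def path_count_right E.path_count_right of_bool_def)

lemma d_up: "d a (Suc b) = d a b + of_bool (jump_up a b)"
  using path_count_E_le[of a b] ray_mono
  by (auto simp: d_def jump_up_def path_count_up E.path_count_up of_bool_def)

lemma d_0: "d 0 0 = 0"
  by (simp add: d_def path_count_def)

lemma d_mono: "a \<le> a' \<Longrightarrow> b \<le> b' \<Longrightarrow> d a b \<le> d a' b'"
proof -
  assume "a \<le> a'" "b \<le> b'"
  from \<open>a \<le> a'\<close> have "d a b \<le> d a' b"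
    by (rule lift_Suc_mono_le[of "\<lambda>a. d a b", rotated]) (simp add: d_right)
  also from \<open>b \<le> b'\<close> have "\<dots> \<le> d a' b'"
    by (rule lift_Suc_mono_le[of "\<lambda>b. d a' b", rotated]) (simp add: d_up)
  finally show ?thesis .
qed

text \<open>\<open>E\<close> has no point left of column \<open>p\<close> or below row
  \<open>q\<close>, so the first \<open>p\<close> columns and \<open>q\<close> rows contribute
  nothing; beyond them it is a copy of \<open>S\<close>.\<close>

lemma path_count_E_shift: "path_count E (a + p) (b + q) = path_count S a b"
proof -
  have *: "(\<Sum>x<n + k. of_bool (k \<le> x \<and> P (x - k))) = (\<Sum>x<n. of_bool (P x) :: nat)"
    for n k and P :: "nat \<Rightarrow> bool"
    by (induction n) auto
  have up: "ray_up E x 0 \<longleftrightarrow> p \<le> x \<and> ray_up S (x - p) 0" for x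
    by (auto simp: ray_up_def E_iff intro: exI[of _ "_ + q"])
  have right: "ray_right E (a + p) y \<longleftrightarrow> q \<le> y \<and> ray_right S a (y - q)" for y
  proof
    assume "ray_right E (a + p) y"
    then obtain x where "a + p \<le> x" "(x, y) \<in> E" by (auto simp: ray_right_def)
    then show "q \<le> y \<and> ray_right S a (y - q)"
      by (auto simp: ray_right_def E_iff intro!: exI[of _ "x - p"])
  qed (auto simp: ray_right_def E_iff intro: exI[of _ "_ + p"])
  show ?thesis
    using *[where n=a and k=p and P="\<lambda>x. ray_up S x 0"] *[where n=b and k=q and P="ray_right S a"]
    by (simp add: path_count_def up right)
qed

text \<open>Beyond the conductor every unit step is counted for \<open>S\<close>. The count for
  \<open>E\<close> equals that for \<open>S\<close> at the point moved back by
  \<open>(p, q)\<close>, so the difference is the number of steps between the two points.\<close>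

lemma d_far:
  assumes "c1 + p \<le> a" "c2 + q \<le> b"
  shows "d a b = p + q"
proof -
  have up: "path_count S (c1 + m) (c2 + n) = path_count S c1 c2 + m + n" for m n
  proof (induction n)
    case 0
    show ?case
    proof (induction m)
      case (Suc m)
      then show ?case
        using conductor[of "c1 + m" c2] by (auto simp: path_count_right ray_up_def)
    qed simp
  next
    case (Suc n)
    then show ?case
      using conductor[of "c1 + m" "c2 + n"] by (auto simp: path_count_up ray_right_def)
  qed
  obtain m n where mn: "a = c1 + m + p" "b = c2 + n + q"
    using assms by (metis add.assoc add.commute le_iff_add)
  show ?thesis
    using up[of "m + p" "n + q"] up[of m n] path_count_E_shift[of "c1 + m" "c2 + n"]
    by (simp add: d_def mn algebra_simps)
qed

lemma d_le: "d a b \<le> p + q"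
  using d_mono[of a "a + c1 + p" b "b + c2 + q"] d_far[of "a + c1 + p" "b + c2 + q"] by simp

text \<open>Without a jump in either direction \<open>E\<close> would meet both rays from
  \<open>(a, b)\<close>, and \<open>E.corner\<close> would put the point itself into
  \<open>E\<close>.\<close>

lemma Ap_jump: "(a, b) \<in> Ap \<Longrightarrow> jump_right a b \<or> jump_up a b"
  using E.corner[of a b] unfolding jump_right_def jump_up_def Ap_def ray_up_def ray_right_def
  by blast

text \<open>For the least \<open>y\<close> the column between \<open>b\<close> and \<open>y\<close> has no jump: a jump would come from an
  element of \<open>S\<close> whose infimum with \<open>(a, y)\<close> contradicts minimality.\<close>

lemma jump_right_Ap:
  assumes "jump_right a b"
  shows "\<exists>y\<ge>b. (a, y) \<in> Ap \<and> d a y = d a b"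
proof -
  define y where "y = (LEAST y. b \<le> y \<and> (a, y) \<in> S)"
  have ex: "\<exists>y. b \<le> y \<and> (a, y) \<in> S"
    using assms by (auto simp: jump_right_def ray_up_def)
  have y: "b \<le> y" "(a, y) \<in> S"
    unfolding y_def using LeastI_ex[OF ex] by auto
  have least: "\<not> (b \<le> z \<and> (a, z) \<in> S)" if "z < y" for z
    using not_less_Least that unfolding y_def by blast
  have "(a, y) \<in> Ap"
    unfolding Ap_def using assms y by (auto simp: jump_right_def ray_up_def)
  have same: "d a z = d a b" if "b \<le> z" "z \<le> y" for z
    using that
  proof (induction z rule: dec_induct)
    case (step w)
    have "ray_up S a w"
      using y step by (auto simp: ray_up_def intro: exI[of _ y])
    then have "\<not> ray_right S a w"
      using corner least[of w] step by fastforce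
    then show ?case
      using step by (simp add: d_up jump_up_def)
  qed simp
  show ?thesis
    using same[of y] y \<open>(a, y) \<in> Ap\<close> by blast
qed

lemma jump_up_Ap:
  assumes "jump_up a b"
  shows "\<exists>x\<ge>a. (x, b) \<in> Ap \<and> d x b = d a b"
proof -
  define x where "x = (LEAST x. a \<le> x \<and> (x, b) \<in> S)"
  have ex: "\<exists>x. a \<le> x \<and> (x, b) \<in> S"
    using assms by (auto simp: jump_up_def ray_right_def)
  have x: "a \<le> x" "(x, b) \<in> S"
    unfolding x_def using LeastI_ex[OF ex] by auto
  have least: "\<not> (a \<le> z \<and> (z, b) \<in> S)" if "z < x" for z
    using not_less_Least that unfolding x_def by blast
  have "(x, b) \<in> Ap"
    unfolding Ap_def using assms x by (auto simp: jump_up_def ray_right_def)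
  have same: "d z b = d a b" if "a \<le> z" "z \<le> x" for z
    using that
  proof (induction z rule: dec_induct)
    case (step w)
    have "ray_right S w b"
      using x step by (auto simp: ray_right_def intro: exI[of _ x])
    then have "\<not> ray_up S w b"
      using corner least[of w] step by fastforce
    then show ?case
      using step by (simp add: d_right jump_right_def)
  qed simp
  show ?thesis
    using same[of x] x \<open>(x, b) \<in> Ap\<close> by blast
qed

text \<open>Steps without a jump leave \<open>d\<close> unchanged, and a jump must come before the
  far region, where \<open>d\<close> is already \<open>p + q\<close>. The measure is the distance to
  that region; at the jump \<open>jump_right_Ap\<close> or \<open>jump_up_Ap\<close> supplies the
  element.\<close>

lemma exists_Ap_above:
  "d a b < p + q \<Longrightarrow> \<exists>a' b'. a \<le> a' \<and> b \<le> b' \<and> (a', b') \<in> Ap \<and> d a' b' = d a b"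
proof (induction "(c1 + p - a) + (c2 + q - b)" arbitrary: a b rule: less_induct)
  case less
  consider "jump_right a b" | "jump_up a b"
    | "\<not> jump_right a b" "\<not> jump_up a b" by blast
  then show ?case
  proof cases
    case 1
    then show ?thesis using jump_right_Ap by blast
  next
    case 2
    then show ?thesis using jump_up_Ap by blast
  next
    case 3
    then have eq: "d (Suc a) b = d a b" "d a (Suc b) = d a b"
      by (simp_all add: d_right d_up)
    show ?thesis
    proof (cases "a < c1 + p")
      case True
      then show ?thesis
        using less.hyps[of "Suc a" b] less.prems eq by (fastforce dest: Suc_leD)
    next
      case False
      then have "b < c2 + q"
        using d_far[of a b] less.prems by linarith
      then show ?thesis
        using less.hyps[of a "Suc b"] less.prems eq False by (fastforce dest: Suc_leD)
    qed
  qed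
qed

section \<open>The levels as fibres of \<open>d\<close>\<close>

text \<open>The direction of the jump out of \<open>(a, b)\<close> is not known, but strict growth
  in both coordinates passes it either way. This is the link between \<open>lele\<close> and
  \<open>d\<close>.\<close>

lemma d_less:
  assumes "(a, b) \<in> Ap" "a < a'" "b < b'"
  shows "d a b < d a' b'"
  using Ap_jump[OF assms(1)] d_right[of a b] d_up[of a b]
    d_mono[of "Suc a" a' b b'] d_mono[of a a' "Suc b" b'] assms by auto

lemma d_less_top: "(a, b) \<in> Ap \<Longrightarrow> d a b < p + q"
  using d_less[of a b "Suc a" "Suc b"] d_le[of "Suc a" "Suc b"] by simp

text \<open>Across the unit square \<open>d\<close> grows by one or two. Growth by one leaves room
  for an Apery element beyond the opposite corner. Growth by two makes all four sides jumps, and the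
  two sides that do not start at \<open>(a, b)\<close> yield Apery elements in column
  \<open>a\<close> and in row \<open>b\<close>. The alternatives are the two ways of not lying in
  \<open>D\<close>: not maximal, or an infimum.\<close>

lemma next_level:
  assumes "(a, b) \<in> Ap" "d a b + 2 \<le> p + q"
  shows "(\<exists>x y. a < x \<and> b < y \<and> (x, y) \<in> Ap \<and> d x y = d a b + 1) \<or>
         (\<exists>x y. a < x \<and> b < y \<and> (a, y) \<in> Ap \<and> (x, b) \<in> Ap
                \<and> d a y = d a b + 1 \<and> d x b = d a b + 1)"
proof (cases "d (Suc a) (Suc b) = d a b + 1")
  case True
  then show ?thesis
    using exists_Ap_above[of "Suc a" "Suc b"] assms by (auto simp: Suc_le_eq)
next
  case False
  have "d a b < d (Suc a) (Suc b)"
    using d_less assms by simp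
  then have jumps: "jump_right a b" "jump_up a b" "jump_right a (Suc b)" "jump_up (Suc a) b"
    using False d_right[of a b] d_up[of "Suc a" b] d_up[of a b] d_right[of a "Suc b"]
    by (auto simp: of_bool_def split: if_splits)
  then show ?thesis
    using jump_right_Ap[of a "Suc b"] jump_up_Ap[of "Suc a" b] d_right[of a b] d_up[of a b]
    by (metis One_nat_def Suc_le_eq of_bool_eq(2))
qed

text \<open>Once the earlier levels are removed, \<open>U\<close> consists of the Apery elements
  with \<open>d\<close> at most \<open>p + q - i\<close>. Those below the bound are discarded by
  \<open>next_level\<close>; those attaining it are maximal by \<open>d_less\<close>, and a jump
  keeps them from being proper infima.\<close>

lemma apery_D_eq:
  assumes min: "min_vec S = (p, q)" and "1 \<le> i"
  shows "apery_D S i = {(a, b) \<in> Ap. d a b + i = p + q}"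
  using \<open>1 \<le> i\<close>
proof (induction i rule: less_induct)
  case (less i)
  define U where "U = {(a, b) \<in> Ap. d a b + i \<le> p + q}"
  define B where "B = lele_maximal U"
  have "apery_set S = Ap"
    unfolding apery_set_def Ap_def E_def min by auto
  moreover have "(\<Union>j\<in>{1..<i}. apery_D S j) = (\<Union>j\<in>{1..<i}. {(a, b) \<in> Ap. d a b + j = p + q})"
    using less by auto
  moreover have "Ap - (\<Union>j\<in>{1..<i}. {(a, b) \<in> Ap. d a b + j = p + q}) = U"
  proof -
    have "(\<exists>j\<in>{1..<i}. d a b + j = p + q) \<longleftrightarrow> \<not> d a b + i \<le> p + q" if "(a, b) \<in> Ap" for a b
      using d_less_top[OF that] by (auto intro!: bexI[of _ "p + q - d a b"])
    then show ?thesis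
      unfolding U_def by auto
  qed
  ultimately have "apery_D S i = B - proper_infima B"
    unfolding B_def by (subst apery_D.simps) (simp add: Let_def)
  also have "\<dots> = {(a, b) \<in> Ap. d a b + i = p + q}"
  proof (intro subset_antisym subrelI)
    fix a b assume "(a, b) \<in> B - proper_infima B"
    then have ab: "(a, b) \<in> B" "(a, b) \<notin> proper_infima B"
      by auto
    then have U: "(a, b) \<in> Ap" "d a b + i \<le> p + q"
      by (auto simp: B_def U_def lele_maximal_def)
    have no: False if "a < x" "b < y" "(x, y) \<in> U" for x y
      using ab that by (auto simp: B_def lele_maximal_def lele_def)
    show "(a, b) \<in> {(a, b) \<in> Ap. d a b + i = p + q}"
    proof (rule ccontr)
      assume "(a, b) \<notin> {(a, b) \<in> Ap. d a b + i = p + q}"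
      with U less.prems have "d a b + 2 \<le> p + q" and le: "d a b + 1 + i \<le> p + q"
        by auto
      from next_level[OF U(1) this(1)] show False
      proof (elim disjE exE conjE)
        fix x y assume "a < x" "b < y" "(x, y) \<in> Ap" "d x y = d a b + 1"
        then show False
          using no[of x y] le by (auto simp: U_def)
      next
        fix x y assume xy: "a < x" "b < y" "(a, y) \<in> Ap" "(x, b) \<in> Ap"
          "d a y = d a b + 1" "d x b = d a b + 1"
        then have "(a, y) \<in> U" "(x, b) \<in> U"
          using le by (auto simp: U_def)
        \<comment> \<open>Maximality is inherited: whatever exceeds \<open>(a, y)\<close> or
          \<open>(x, b)\<close> in both coordinates also exceeds \<open>(a, b)\<close> in both,
          which \<open>no\<close> excludes.\<close>
        then have "(a, y) \<in> B" "(x, b) \<in> B"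
          using no less_trans[OF xy(1)] less_trans[OF xy(2)] xy(1,2)
          by (fastforce simp: B_def lele_maximal_def lele_def)+
        moreover have "(a, b) = inf (a, y) (x, b)"
          using xy by (simp add: inf_prod_def inf_nat_def)
        ultimately show False
          using ab xy unfolding proper_infima_def
          by (metis (mono_tags, lifting) Diff_iff mem_Collect_eq nat_neq_iff prod.inject singletonD)
      qed
    qed
  next
    fix a b assume "(a, b) \<in> {(a, b) \<in> Ap. d a b + i = p + q}"
    then have ab: "(a, b) \<in> Ap" "d a b + i = p + q"
      by auto
    have "False" if "a < x" "b < y" "(x, y) \<in> U" for x y
      using that d_less[OF ab(1) that(1,2)] ab by (auto simp: U_def)
    with ab have "(a, b) \<in> B"
      by (auto simp: B_def U_def lele_maximal_def lele_def)
    moreover have "(a, b) \<notin> proper_infima B"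
    proof
      assume "(a, b) \<in> proper_infima B"
      then obtain \<beta>1 \<beta>2 where \<beta>: "\<beta>1 \<in> B - {(a, b)}" "\<beta>2 \<in> B - {(a, b)}" "(a, b) = inf \<beta>1 \<beta>2"
        unfolding proper_infima_def by blast
      obtain x1 y1 x2 y2 where "\<beta>1 = (x1, y1)" "\<beta>2 = (x2, y2)"
        by fastforce
      with \<beta> have
        B: "(x1, y1) \<in> B" "(x1, y1) \<noteq> (a, b)" "(x2, y2) \<in> B" "(x2, y2) \<noteq> (a, b)"
        and inf: "a = min x1 x2" "b = min y1 y2"
        by (simp_all add: inf_nat_def)
      have d: "d x1 y1 \<le> d a b" "d x2 y2 \<le> d a b"
        using B ab by (auto simp: B_def lele_maximal_def U_def)
      have ge: "a \<le> x1" "a \<le> x2" "b \<le> y1" "b \<le> y2"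
        using inf by simp_all
      from Ap_jump[OF ab(1)] show False
      proof
        assume "jump_right a b"
        then have "d (Suc a) b = d a b + 1" by (simp add: d_right)
        \<comment> \<open>Passing the jump would push \<open>d\<close> above the bound valid in
          \<open>U\<close>. So both points lie in column \<open>a\<close>, and the lower of them is
          \<open>(a, b)\<close> itself, contrary to their choice.\<close>
        then have "\<not> Suc a \<le> x1" "\<not> Suc a \<le> x2"
          using d ge d_mono[of "Suc a" x1 b y1] d_mono[of "Suc a" x2 b y2] by linarith+
        with B inf show False by (auto simp: min_def split: if_splits)
      next
        assume "jump_up a b"
        then have "d a (Suc b) = d a b + 1" by (simp add: d_up)
        then have "\<not> Suc b \<le> y1" "\<not> Suc b \<le> y2"
          using d ge d_mono[of a x1 "Suc b" y1] d_mono[of a x2 "Suc b" y2] by linarith+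
        with B inf show False by (auto simp: min_def split: if_splits)
      qed
    qed
    ultimately show "(a, b) \<in> B - proper_infima B" by blast
  qed
  finally show ?case .
qed

text \<open>On \<open>Ap\<close> the value of \<open>d\<close> stays below \<open>p + q\<close>, so
  \<open>p + q\<close> levels exhaust it. None can be spared, since an Apery element with
  \<open>d = 0\<close> exists and lies only in the last one.\<close>

lemma apery_N_eq:
  assumes min: "min_vec S = (p, q)"
  shows "apery_N S = p + q"
  unfolding apery_N_def
proof (rule Least_equality)
  have Ap: "apery_set S = Ap"
    unfolding apery_set_def Ap_def E_def min by auto
  have D: "(\<Union>i\<in>{1..N}. apery_D S i) = (\<Union>i\<in>{1..N}. {(a, b) \<in> Ap. d a b + i = p + q})" for N
    using apery_D_eq[OF min] by auto
  have "\<exists>i\<in>{1..p + q}. d a b + i = p + q" if "(a, b) \<in> Ap" for a b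
    using d_less_top[OF that] by (intro bexI[of _ "p + q - d a b"]) auto
  then show "apery_set S = (\<Union>i\<in>{1..p + q}. apery_D S i)"
    unfolding Ap D by auto
  fix N assume N: "apery_set S = (\<Union>i\<in>{1..N}. apery_D S i)"
  show "p + q \<le> N"
  proof (cases "p + q = 0")
    case False
    then obtain a b where "(a, b) \<in> Ap" "d a b = 0"
      using exists_Ap_above[of 0 0] by (auto simp: d_0)
    with N show ?thesis unfolding Ap D by force
  qed simp
qed

lemma apery_level_eq:
  assumes "min_vec S = (p, q)" "k \<in> {1..p + q}"
  shows "apery_level S k = {(a, b) \<in> Ap. d a b + 1 = k}"
  using assms(2) unfolding apery_level_def apery_N_eq[OF assms(1)]
  by (subst apery_D_eq[OF assms(1)]) auto

section \<open>A chain through all levels\<close>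

text \<open>Stronger than \<open>\<alpha> < \<beta>\<close>: once a ring element is reduced against
  one of value \<open>\<alpha>\<close>, the remainder lies just past a jump out of
  \<open>\<alpha>\<close>, and this corner must still be below the next chain element.\<close>

definition jump_step :: "nat \<times> nat \<Rightarrow> nat \<times> nat \<Rightarrow> bool" where
  "jump_step \<alpha> \<beta> \<longleftrightarrow>
     jump_right (fst \<alpha>) (snd \<alpha>) \<and> (Suc (fst \<alpha>), snd \<alpha>) \<le> \<beta> \<or>
     jump_up (fst \<alpha>) (snd \<alpha>) \<and> (fst \<alpha>, Suc (snd \<alpha>)) \<le> \<beta>"

lemma exists_jump_chain:
  "\<exists>\<alpha> :: nat \<Rightarrow> nat \<times> nat.
     (\<forall>k\<in>{1..p + q}. \<alpha> k \<in> Ap \<and> d (fst (\<alpha> k)) (snd (\<alpha> k)) + 1 = k) \<and>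
     (\<forall>k\<in>{1..<p + q}. jump_step (\<alpha> k) (\<alpha> (Suc k)))"
proof -
  \<comment> \<open>Indices start at 0 to agree with \<open>d\<close> and are shifted by one at the
    end; the guards keep the choice total beyond the last level.\<close>
  have "\<exists>\<alpha>. \<forall>n. (n < p + q \<longrightarrow> \<alpha> n \<in> Ap \<and> d (fst (\<alpha> n)) (snd (\<alpha> n)) = n) \<and>
      (Suc n < p + q \<longrightarrow> jump_step (\<alpha> n) (\<alpha> (Suc n)))"
  proof (rule dependent_nat_choice)
    show "\<exists>\<alpha>. 0 < p + q \<longrightarrow> \<alpha> \<in> Ap \<and> d (fst \<alpha>) (snd \<alpha>) = 0"
      using exists_Ap_above[of 0 0] by (auto simp: d_0)
  next
    fix \<alpha> n assume \<alpha>: "n < p + q \<longrightarrow> \<alpha> \<in> Ap \<and> d (fst \<alpha>) (snd \<alpha>) = n"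
    show "\<exists>\<beta>. (Suc n < p + q \<longrightarrow> \<beta> \<in> Ap \<and> d (fst \<beta>) (snd \<beta>) = Suc n) \<and>
              (Suc n < p + q \<longrightarrow> jump_step \<alpha> \<beta>)"
    proof (cases "Suc n < p + q")
      case True
      obtain a b where ab: "\<alpha> = (a, b)" by (cases \<alpha>)
      with \<alpha> True consider "jump_right a b" | "jump_up a b"
        using Ap_jump[of a b] by auto
      then show ?thesis
      proof cases
        case 1
        then have "d (Suc a) b = Suc n" using \<alpha> True ab by (simp add: d_right)
        then show ?thesis
          using exists_Ap_above[of "Suc a" b] True 1 ab by (auto simp: jump_step_def)
      next
        case 2
        then have "d a (Suc b) = Suc n" using \<alpha> True ab by (simp add: d_up)
        then show ?thesis
          using exists_Ap_above[of a "Suc b"] True 2 ab by (auto simp: jump_step_def)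
      qed
    qed auto
  qed
  then obtain \<alpha> where \<alpha>:
    "\<And>n. n < p + q \<Longrightarrow> \<alpha> n \<in> Ap \<and> d (fst (\<alpha> n)) (snd (\<alpha> n)) = n"
    "\<And>n. Suc n < p + q \<Longrightarrow> jump_step (\<alpha> n) (\<alpha> (Suc n))"
    by blast
  show ?thesis
  proof (intro exI[of _ "\<lambda>k. \<alpha> (k - 1)"] conjI ballI)
    fix k assume "k \<in> {1..p + q}"
    then show "\<alpha> (k - 1) \<in> Ap" "d (fst (\<alpha> (k - 1))) (snd (\<alpha> (k - 1))) + 1 = k"
      using \<alpha>(1)[of "k - 1"] by auto
  next
    fix k assume "k \<in> {1..<p + q}"
    then show "jump_step (\<alpha> (k - 1)) (\<alpha> (Suc k - 1))"
      using \<alpha>(2)[of "k - 1"] by auto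
  qed
qed

lemma jump_step_less: "jump_step \<alpha> \<beta> \<Longrightarrow> \<alpha> < \<beta>"
  by (cases \<alpha>; cases \<beta>) (auto simp: jump_step_def less_le)

end

section \<open>Discrete valuation rings\<close>

locale dvr = principal_domain V for V (structure) +
  assumes not_field: "\<not> field V"
    and unique_maximal: "\<exists>!M. maximalideal M V"
begin

definition uniformizer :: "'a \<Rightarrow> bool" where
  "uniformizer t \<longleftrightarrow> t \<in> carrier V \<and> maximalideal (PIdl t) V"

text \<open>\<open>dvr_val\<close> is a definite description without meaning at zero; the value
  \<infinity> there lets the product and sum rules hold without exception.\<close>

definition val :: "'a \<Rightarrow> enat" where
  "val f = (if f = \<zero> then \<infinity> else enat (dvr_val V f))"

lemma exists_uniformizer: "\<exists>t. uniformizer t"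
  using unique_maximal exists_gen unfolding uniformizer_def by (metis maximalideal.axioms(1))

lemma uniformizer_nonzero: "uniformizer t \<Longrightarrow> t \<noteq> \<zero>"
proof
  assume "uniformizer t" "t = \<zero>"
  moreover have "PIdl \<zero> = {\<zero>}"
    by (auto simp: cgenideal_def intro: exI[of _ \<zero>])
  ultimately show False
    using zeromaximalideal_eq_field not_field by (simp add: uniformizer_def)
qed

lemma uniformizer_not_unit: "uniformizer t \<Longrightarrow> t \<notin> Units V"
  using maximalideal.I_notcarr ideal_eq_carrier_iff unfolding uniformizer_def by blast

lemma irreducible_uniformizer:
  "p \<in> carrier V \<Longrightarrow> ring_irreducible p \<Longrightarrow> uniformizer p"
  using irreducible_imp_maximalideal unfolding uniformizer_def by blast

lemma uniformizers_associated:
  assumes "uniformizer s" "uniformizer t"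
  shows "\<exists>u\<in>Units V. s = u \<otimes> t"
  using assms unique_maximal associated_iff_same_ideal[of s t] ring_associated_iff[of s t]
  unfolding uniformizer_def by blast

text \<open>In a principal domain every irreducible generates a maximal ideal. There is only one
  such ideal, so every irreducible is a unit times \<open>t\<close>.\<close>

lemma irreducible_product:
  assumes "uniformizer t" "set fs \<subseteq> carrier V - {\<zero>}" "\<forall>p\<in>set fs. irreducible (mult_of V) p"
  shows "\<exists>u\<in>Units V. foldr (\<otimes>) fs \<one> = u \<otimes> t [^] length fs"
  using assms(2,3)
proof (induction fs)
  case Nil
  then show ?case by (intro bexI[of _ \<one>]) auto
next
  case (Cons p fs)
  then obtain u where u: "u \<in> Units V" "foldr (\<otimes>) fs \<one> = u \<otimes> t [^] length fs" by auto
  have "ring_irreducible p"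
    using Cons.prems ring_irreducibleI' by auto
  then obtain w where w: "w \<in> Units V" "p = w \<otimes> t"
    using uniformizers_associated[OF irreducible_uniformizer assms(1)] Cons.prems by auto
  have [simp]: "t \<in> carrier V" "u \<in> carrier V" "w \<in> carrier V"
    using assms u w by (auto simp: uniformizer_def)
  have "foldr (\<otimes>) (p # fs) \<one> = (w \<otimes> u) \<otimes> t [^] length (p # fs)"
    using u w by (simp add: m_ac)
  with u w show ?case by blast
qed

lemma exists_unit_pow:
  assumes "uniformizer t" "f \<in> carrier V" "f \<noteq> \<zero>"
  shows "\<exists>n::nat. \<exists>u\<in>Units V. f = u \<otimes> t [^] n"
proof -
  obtain fs where fs: "set fs \<subseteq> carrier V - {\<zero>}" "wfactors (mult_of V) fs f"
    using mult_of.wfactors_exist[of f] assms by auto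
  then obtain u where u: "u \<in> Units V" "foldr (\<otimes>) fs \<one> = u \<otimes> t [^] length fs"
    using irreducible_product[OF assms(1)] unfolding wfactors_def by blast
  have t [simp]: "t \<in> carrier V" "u \<in> carrier V"
    using assms u by (auto simp: uniformizer_def)
  have "f \<sim>\<^bsub>mult_of V\<^esub> u \<otimes> t [^] length fs"
    using fs u by (simp add: wfactors_def mult_of.associated_sym)
  then have "f \<sim> u \<otimes> t [^] length fs"
    using assms assoc_iff_assoc_mult by simp
  then obtain w where "w \<in> Units V" "f = w \<otimes> (u \<otimes> t [^] length fs)"
    using ring_associated_iff assms by auto
  then have "f = (w \<otimes> u) \<otimes> t [^] length fs" "w \<otimes> u \<in> Units V"
    using u by (auto simp: m_assoc Units_closed)
  then show ?thesis by blast
qed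

text \<open>Two uniformizers occur because \<open>dvr_val\<close> quantifies over the uniformizer as
  well. They differ by a unit, and cancelling powers of \<open>t\<close> with unequal exponents
  would make \<open>t\<close> a unit.\<close>

lemma unit_pow_unique:
  assumes t: "uniformizer t" and s: "uniformizer s" and u: "u \<in> Units V" and w: "w \<in> Units V"
    and eq: "u \<otimes> t [^] (n::nat) = w \<otimes> s [^] (k::nat)"
  shows "n = k"
proof -
  have le: "n \<le> k"
    if "uniformizer t" "u \<in> Units V" "w \<in> Units V" "u \<otimes> t [^] n = w \<otimes> t [^] k"
    for u w t and n k :: nat
  proof (rule ccontr)
    assume "\<not> n \<le> k"
    then obtain m where m: "n = k + Suc m" by (metis add_Suc_right less_imp_Suc_add not_le)
    have [simp]: "t \<in> carrier V" "u \<in> carrier V" "w \<in> carrier V"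
      using that by (auto simp: uniformizer_def)
    have "t [^] k \<noteq> \<zero>"
      using uniformizer_nonzero[OF that(1)] by (induction k) (auto simp: integral_iff)
    moreover have "t [^] k \<otimes> (u \<otimes> t [^] m \<otimes> t) = t [^] k \<otimes> w"
      using that(4) unfolding m by (simp add: nat_pow_mult[symmetric] m_ac)
    ultimately have "w = (u \<otimes> t [^] m) \<otimes> t"
      by (simp add: m_lcancel)
    then have "t divides w" by (intro dividesI[of "u \<otimes> t [^] m"]) (auto simp: m_ac)
    then have "t \<in> Units V"
      using that(3) by (meson Unit_eq_dividesone \<open>t \<in> carrier V\<close> \<open>w \<in> carrier V\<close> divides_trans one_closed)
    then show False
      using uniformizer_not_unit that by blast
  qed
  obtain v where v: "v \<in> Units V" "s = v \<otimes> t"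
    using uniformizers_associated[OF s t] by blast
  have [simp]: "t \<in> carrier V" "v \<in> carrier V" "w \<in> carrier V"
    using t v w by (auto simp: uniformizer_def)
  have "w \<otimes> s [^] k = (w \<otimes> v [^] k) \<otimes> t [^] k"
    using v by (simp add: nat_pow_distrib m_assoc)
  moreover have "w \<otimes> v [^] k \<in> Units V"
    using w v Units_pow_closed by simp
  ultimately show ?thesis
    using le[OF t u, of "w \<otimes> v [^] k" n k] le[OF t _ u, of "w \<otimes> v [^] k" k n] eq
    by (simp add: le_antisym)
qed

lemma val_eq:
  assumes "uniformizer t" "u \<in> Units V"
  shows "val (u \<otimes> t [^] n) = enat n"
proof -
  have [simp]: "t \<in> carrier V" "u \<in> carrier V"
    using assms by (auto simp: uniformizer_def)
  have "t [^] n \<noteq> \<zero>"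
    using uniformizer_nonzero[OF assms(1)] by (induction n) (auto simp: integral_iff)
  moreover have "u \<noteq> \<zero>"
    using assms(2) by (metis Units_inv_closed Units_r_inv l_null zero_not_one)
  moreover have "dvr_val V (u \<otimes> t [^] n) = n"
    unfolding dvr_val_def
  proof (rule the_equality)
    show "\<exists>s\<in>carrier V. \<exists>w\<in>Units V. maximalideal (PIdl s) V \<and> u \<otimes> t [^] n = w \<otimes> s [^] n"
      using assms by (auto simp: uniformizer_def)
    fix k :: nat assume "\<exists>s\<in>carrier V. \<exists>w\<in>Units V. maximalideal (PIdl s) V \<and> u \<otimes> t [^] n = w \<otimes> s [^] k"
    then show "k = n"
      using unit_pow_unique[OF assms(1) _ assms(2)] by (auto simp: uniformizer_def)
  qed
  ultimately show ?thesis
    by (simp add: val_def integral_iff)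
qed

lemma val_zero: "val \<zero> = \<infinity>"
  by (simp add: val_def)

lemma val_mult:
  assumes [simp]: "f \<in> carrier V" "g \<in> carrier V"
  shows "val (f \<otimes> g) = val f + val g"
proof (cases "f = \<zero> \<or> g = \<zero>")
  case True
  then show ?thesis by (auto simp: val_zero)
next
  case False
  obtain t where t: "uniformizer t" using exists_uniformizer by blast
  obtain n u m w where fg: "u \<in> Units V" "f = u \<otimes> t [^] (n::nat)" "w \<in> Units V" "g = w \<otimes> t [^] (m::nat)"
    using exists_unit_pow[OF t] False assms by metis
  have [simp]: "t \<in> carrier V" "u \<in> carrier V" "w \<in> carrier V"
    using fg t by (auto simp: uniformizer_def)
  have "f \<otimes> g = (u \<otimes> w) \<otimes> t [^] (n + m)"
    by (simp add: fg nat_pow_mult[symmetric] m_ac)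
  then show ?thesis
    using fg val_eq[OF t] by simp
qed

lemma val_le_imp_divides:
  assumes "f \<in> carrier V" "h \<in> carrier V" "val h \<le> val f"
  shows "\<exists>c\<in>carrier V. f = h \<otimes> c"
proof (cases "f = \<zero>")
  case True
  then show ?thesis using assms by (intro bexI[of _ \<zero>]) auto
next
  case False
  then have "h \<noteq> \<zero>"
    using assms by (auto simp: val_def)
  obtain t where t: "uniformizer t" using exists_uniformizer by blast
  obtain n u m w where fg: "u \<in> Units V" "f = u \<otimes> t [^] (n::nat)" "w \<in> Units V" "h = w \<otimes> t [^] (m::nat)"
    using exists_unit_pow[OF t] False \<open>h \<noteq> \<zero>\<close> assms by metis
  have [simp]: "t \<in> carrier V" "u \<in> carrier V" "w \<in> carrier V"
    using fg t by (auto simp: uniformizer_def)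
  have "m \<le> n"
    using assms(3) val_eq[OF t] fg by simp
  then obtain k where "n = m + k" using le_Suc_ex by blast
  then have "h \<otimes> (inv w \<otimes> u \<otimes> t [^] k) = (w \<otimes> inv w) \<otimes> (u \<otimes> t [^] n)"
    using fg by (simp add: nat_pow_mult[symmetric] m_ac del: Units_r_inv Units_l_inv)
  then have "f = h \<otimes> (inv w \<otimes> u \<otimes> t [^] k)"
    unfolding Units_r_inv[OF fg(3)] fg(2)[symmetric] l_one[OF assms(1)] by (rule sym)
  then show ?thesis
    by (rule bexI) (use fg(3) in simp)
qed

text \<open>The element of smaller value divides the other one, hence also the sum.\<close>

lemma val_add:
  assumes "f \<in> carrier V" "g \<in> carrier V"
  shows "min (val f) (val g) \<le> val (f \<oplus> g)"
proof -
  have *: "val f \<le> val (f \<oplus> g)" if fg: "f \<in> carrier V" "g \<in> carrier V" "val f \<le> val g" for f g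
  proof -
    obtain c where "c \<in> carrier V" "g = f \<otimes> c"
      using val_le_imp_divides[OF fg(2,1,3)] by blast
    then have "f \<oplus> g = f \<otimes> (\<one> \<oplus> c)"
      using fg by (simp add: r_distr)
    then show ?thesis
      using val_mult[of f "\<one> \<oplus> c"] fg \<open>c \<in> carrier V\<close> by simp
  qed
  show ?thesis
    using *[of f g] *[of g f] assms by (cases "val f \<le> val g") (auto simp: a_comm min_def)
qed

lemma val_one: "val \<one> = 0"
proof -
  obtain t where t: "uniformizer t" using exists_uniformizer by blast
  show ?thesis
    using val_eq[OF t, of \<one> 0] by (simp add: zero_enat_def)
qed

lemma val_eq_0_iff:
  assumes "f \<in> carrier V"
  shows "val f = 0 \<longleftrightarrow> f \<in> Units V"
proof
  assume "val f = 0"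
  then obtain c where "c \<in> carrier V" "\<one> = f \<otimes> c"
    using val_le_imp_divides[of \<one> f] assms by auto
  then show "f \<in> Units V"
    using assms m_comm by (auto simp: Units_def)
next
  assume "f \<in> Units V"
  then have "val f + val (inv f) = 0"
    using val_mult[of f "inv f"] assms by (simp add: val_one)
  then show "val f = 0" by simp
qed

lemma exists_val: "\<exists>f\<in>carrier V. val f = enat n"
proof -
  obtain t where t: "uniformizer t" using exists_uniformizer by blast
  then show ?thesis
    using val_eq[OF t, of \<one> n] by (auto simp: uniformizer_def intro!: bexI[of _ "t [^] n"])
qed

end

lemma discrete_valuation_ring_dvr: "discrete_valuation_ring V \<Longrightarrow> dvr V"
  by (simp add: discrete_valuation_ring_def dvr_def dvr_axioms_def)

section \<open>Rings with two valuations\<close>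

lemma zero_FactRing: "\<zero>\<^bsub>R Quot I\<^esub> = I"
  by (simp add: FactRing_def)

lemma carrier_FactRing: "carrier (R Quot I) = (\<lambda>a. I +>\<^bsub>R\<^esub> a) ` carrier R"
  by (auto simp: FactRing_def A_RCOSETS_def')

text \<open>The intended \<open>v\<close> is a valuation pulled back from one of the two factors. It
  is infinite on the whole kernel of the projection, so \<infinity> also occurs at nonzero
  elements.\<close>

locale valued_ring = cring R for R (structure) +
  fixes v :: "'a \<Rightarrow> enat"
  assumes v_mult: "\<lbrakk>f \<in> carrier R; g \<in> carrier R\<rbrakk> \<Longrightarrow> v (f \<otimes> g) = v f + v g"
    and v_add: "\<lbrakk>f \<in> carrier R; g \<in> carrier R\<rbrakk> \<Longrightarrow> min (v f) (v g) \<le> v (f \<oplus> g)"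
    and v_uminus: "f \<in> carrier R \<Longrightarrow> v (\<ominus> f) = v f"
begin

lemma v_add_ge: "\<lbrakk>f \<in> carrier R; g \<in> carrier R; n \<le> v f; n \<le> v g\<rbrakk> \<Longrightarrow> n \<le> v (f \<oplus> g)"
  using v_add[of f g] by (auto simp: min_def split: if_splits)

lemma v_minus_ge: "\<lbrakk>f \<in> carrier R; g \<in> carrier R; n \<le> v f; n \<le> v g\<rbrakk> \<Longrightarrow> n \<le> v (f \<ominus> g)"
  using v_add_ge[of f "\<ominus> g" n] by (simp add: v_uminus a_minus_def)

lemma v_add_less:
  assumes "f \<in> carrier R" "g \<in> carrier R" "v f < v g"
  shows "v (f \<oplus> g) = v f"
proof (rule antisym)
  have "f = (f \<oplus> g) \<ominus> g"
    using assms by (simp add: a_minus_def a_assoc r_neg)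
  then have "min (v (f \<oplus> g)) (v g) \<le> v f"
    using v_minus_ge[of "f \<oplus> g" g "min (v (f \<oplus> g)) (v g)"] assms by simp
  then show "v (f \<oplus> g) \<le> v f"
    using assms by (auto simp: min_def split: if_splits)
  show "v f \<le> v (f \<oplus> g)"
    using assms by (intro v_add_ge) auto
qed

lemma v_add_less': "\<lbrakk>f \<in> carrier R; g \<in> carrier R; v g < v f\<rbrakk> \<Longrightarrow> v (f \<oplus> g) = v g"
  using v_add_less[of g f] by (simp add: a_comm)

lemma v_minus_less: "\<lbrakk>f \<in> carrier R; g \<in> carrier R; v f < v g\<rbrakk> \<Longrightarrow> v (f \<ominus> g) = v f"
  using v_add_less[of f "\<ominus> g"] by (simp add: v_uminus a_minus_def)

end

text \<open>The interface between algebra and combinatorics. The \<open>residue\<close> conditions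
  express residual rationality with representatives in \<open>K\<close>; \<open>realize\<close> and
  \<open>divide\<close> come from an element of value \<open>(\<delta>1, \<delta>2)\<close> that
  multiplies the integral closure into \<open>R\<close>.\<close>

locale two_valued_ring = cring R + v1: valued_ring R v1 + v2: valued_ring R v2
  for R :: "('a, 'r) ring_scheme" (structure) and v1 v2 :: "'a \<Rightarrow> enat" +
  fixes K :: "'a set" and \<delta>1 \<delta>2 :: nat
  assumes K_subset: "K \<subseteq> carrier R"
    and residue1: "\<lbrakk>f \<in> carrier R; h \<in> carrier R; v1 h \<noteq> \<infinity>; v1 h \<le> v1 f\<rbrakk>
      \<Longrightarrow> \<exists>c\<in>K. v1 h < v1 (f \<ominus> c \<otimes> h)"
    and residue2: "\<lbrakk>f \<in> carrier R; h \<in> carrier R; v2 h \<noteq> \<infinity>; v2 h \<le> v2 f\<rbrakk>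
      \<Longrightarrow> \<exists>c\<in>K. v2 h < v2 (f \<ominus> c \<otimes> h)"
    and realize: "\<lbrakk>\<delta>1 \<le> a; \<delta>2 \<le> b\<rbrakk> \<Longrightarrow> \<exists>f\<in>carrier R. v1 f = enat a \<and> v2 f = enat b"
    and divide: "\<lbrakk>x \<in> carrier R; f \<in> carrier R; v1 x \<noteq> \<infinity>; v2 x \<noteq> \<infinity>;
        v1 x + enat \<delta>1 \<le> v1 f; v2 x + enat \<delta>2 \<le> v2 f\<rbrakk> \<Longrightarrow> \<exists>g\<in>carrier R. f = x \<otimes> g"
begin

text \<open>Exchanging the branches turns horizontal statements into vertical ones.\<close>

lemma swap: "two_valued_ring R v2 v1 K \<delta>2 \<delta>1"
  by (intro two_valued_ring.intro two_valued_ring_axioms.intro cring_axioms v1.valued_ring_axioms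
      v2.valued_ring_axioms)
    (fact K_subset, erule (3) residue2, erule (3) residue1, use realize in blast,
      erule (5) divide)

definition vals :: "(nat \<times> nat) set" where
  "vals = {(a, b). \<exists>f\<in>carrier R. v1 f = enat a \<and> v2 f = enat b}"

lemma vals_swap: "two_valued_ring.vals R v2 v1 = {(b, a). (a, b) \<in> vals}"
  unfolding vals_def two_valued_ring.vals_def[OF swap] by auto

text \<open>Elements that are zero divisors, i.e. have an infinite value, are perturbed by elements of
  the conductor.\<close>

lemma perturb:
  assumes "h \<in> carrier R" "enat n \<le> v1 h" "v2 h = enat b"
  shows "\<exists>a\<ge>n. (a, b) \<in> vals"
proof (cases "v1 h")
  case (enat a)
  then show ?thesis using assms by (auto simp: vals_def)
next
  case infinity
  obtain w where w: "w \<in> carrier R" "v1 w = enat (n + \<delta>1)" "v2 w = enat (Suc b + \<delta>2)"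
    using realize[of "n + \<delta>1" "Suc b + \<delta>2"] by auto
  then have "v1 (h \<oplus> w) = enat (n + \<delta>1)" "v2 (h \<oplus> w) = enat b"
    using v1.v_add_less'[of h w] v2.v_add_less[of h w] assms infinity by auto
  then show ?thesis
    using assms w by (intro exI[of _ "n + \<delta>1"]) (auto simp: vals_def)
qed

text \<open>Subtracting a suitable multiple \<open>c \<otimes> g\<close> cancels the leading part of
  \<open>f\<close> for \<open>v1\<close>, while \<open>v2\<close> stays \<open>b\<close> because
  \<open>g\<close> has the larger second value. \<open>perturb\<close> covers the case that the new
  first value is infinite.\<close>

lemma vals_exchange:
  assumes "(a, b) \<in> vals" "(a, y) \<in> vals" "b < y"
  shows "\<exists>x>a. (x, b) \<in> vals"
proof -
  obtain f g where f: "f \<in> carrier R" "v1 f = enat a" "v2 f = enat b"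
    and g: "g \<in> carrier R" "v1 g = enat a" "v2 g = enat y"
    using assms by (auto simp: vals_def)
  obtain c where c: "c \<in> K" "enat a < v1 (f \<ominus> c \<otimes> g)"
    using residue1[of f g] f g by auto
  have "c \<in> carrier R" using c K_subset by auto
  have "v2 f < v2 (c \<otimes> g)"
    using v2.v_mult[of c g] f g \<open>c \<in> carrier R\<close> assms(3)
    by (cases "v2 c") auto
  then have "v2 (f \<ominus> c \<otimes> g) = enat b"
    using v2.v_minus_less[of f "c \<otimes> g"] f g \<open>c \<in> carrier R\<close> by simp
  then show ?thesis
    using perturb[of "f \<ominus> c \<otimes> g" "Suc a" b] f g c \<open>c \<in> carrier R\<close>
    by (auto simp: Suc_le_eq Suc_ile_eq)
qed

text \<open>The strict inequalities exclude cancellation in \<open>f \<oplus> g\<close>. In all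
  other cases the infimum is one of the two given points.\<close>

lemma vals_inf:
  assumes "(a, b) \<in> vals" "(a', b') \<in> vals" "a < a'" "b' < b"
  shows "(a, b') \<in> vals"
proof -
  obtain f g where f: "f \<in> carrier R" "v1 f = enat a" "v2 f = enat b"
    and g: "g \<in> carrier R" "v1 g = enat a'" "v2 g = enat b'"
    using assms by (auto simp: vals_def)
  then have "v1 (f \<oplus> g) = enat a" "v2 (f \<oplus> g) = enat b'"
    using v1.v_add_less[of f g] v2.v_add_less'[of f g] assms by auto
  then show ?thesis
    using f g by (auto simp: vals_def intro!: bexI[of _ "f \<oplus> g"])
qed

lemma good_set_vals: "good_set vals"
proof
  fix a b a' b' assume ab: "(a, b) \<in> vals" "(a', b') \<in> vals"
  show "(min a a', min b b') \<in> vals"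
    using vals_inf[OF ab] vals_inf[OF ab(2,1)] ab
    by (cases "a < a'"; cases "b' < b"; cases "a' < a"; cases "b < b'") (auto simp: min_def)
next
  fix a b y assume "(a, b) \<in> vals" "(a, y) \<in> vals" "b < y"
  then show "\<exists>x>a. (x, b) \<in> vals" by (rule vals_exchange)
next
  fix a b x assume "(a, b) \<in> vals" "(x, b) \<in> vals" "a < x"
  then show "\<exists>y>b. (a, y) \<in> vals"
    using two_valued_ring.vals_exchange[OF swap, of b a x] by (auto simp: vals_swap)
qed

text \<open>The case without a drop: if \<open>f\<close> has first value \<open>a\<close>, then so
  has some multiple of \<open>x\<close> in the same range, and a scalar from \<open>K\<close> makes
  the leading parts cancel.\<close>

lemma step:
  assumes x: "x \<in> carrier R" and f: "f \<in> carrier R" "enat a \<le> v1 f" "enat b \<le> v2 f"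
    and no_jump: "\<And>y. b \<le> y \<Longrightarrow> (a, y) \<in> vals \<Longrightarrow>
      \<exists>g\<in>carrier R. v1 (x \<otimes> g) = enat a \<and> enat b \<le> v2 (x \<otimes> g)"
  shows "\<exists>r\<in>carrier R. enat (Suc a) \<le> v1 (f \<ominus> x \<otimes> r) \<and> enat b \<le> v2 (f \<ominus> x \<otimes> r)"
proof (cases "v1 f = enat a")
  case False
  then have "enat (Suc a) \<le> v1 f"
    using f by (metis Suc_ile_eq order_le_less)
  then show ?thesis
    using x f by (intro bexI[of _ \<zero>]) (auto simp: a_minus_def)
next
  case True
  \<comment> \<open>The second value of \<open>f\<close> may be infinite, so the point of
    \<open>vals\<close> on the ray comes from a perturbation of \<open>f\<close>.\<close>
  obtain y where "b \<le> y" "(a, y) \<in> vals"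
    using two_valued_ring.perturb[OF swap f(1,3) True] by (auto simp: vals_swap)
  then obtain g where g: "g \<in> carrier R" "v1 (x \<otimes> g) = enat a" "enat b \<le> v2 (x \<otimes> g)"
    using no_jump by blast
  then obtain c where c: "c \<in> K" "enat a < v1 (f \<ominus> c \<otimes> (x \<otimes> g))"
    using residue1[of f "x \<otimes> g"] f x by auto
  have "c \<in> carrier R" using c K_subset by auto
  then have eq: "c \<otimes> (x \<otimes> g) = x \<otimes> (c \<otimes> g)"
    using x g by (simp add: m_ac)
  have "enat b \<le> v2 (x \<otimes> (c \<otimes> g))"
    using v2.v_mult[of c "x \<otimes> g"] eq x g \<open>c \<in> carrier R\<close>
    by (metis add_increasing m_closed zero_le)
  then have "enat b \<le> v2 (f \<ominus> x \<otimes> (c \<otimes> g))"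
    using v2.v_minus_ge f x g \<open>c \<in> carrier R\<close> by simp
  then show ?thesis
    using c eq g \<open>c \<in> carrier R\<close> by (intro bexI[of _ "c \<otimes> g"]) (auto simp: Suc_ile_eq)
qed

end

section \<open>The filtration modulo a fixed element\<close>

locale two_valued_ring_elem = two_valued_ring +
  fixes x :: 'a and p q :: nat
  assumes x: "x \<in> carrier R" "v1 x = enat p" "v2 x = enat q"
begin

sublocale plane: apery_plane vals p q \<delta>1 \<delta>2
proof (intro apery_plane.intro good_set_vals apery_plane_axioms.intro)
  fix a b assume "(a, b) \<in> vals"
  then obtain f where "f \<in> carrier R" "v1 f = enat a" "v2 f = enat b"
    by (auto simp: vals_def)
  then show "(a + p, b + q) \<in> vals"
    using x v1.v_mult[of f x] v2.v_mult[of f x] by (auto simp: vals_def intro!: bexI[of _ "f \<otimes> x"])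
next
  fix a b assume "\<delta>1 \<le> a" "\<delta>2 \<le> b"
  then show "(a, b) \<in> vals"
    using realize by (auto simp: vals_def)
qed

definition Fil :: "nat \<Rightarrow> nat \<Rightarrow> 'a set" where
  "Fil a b = {f \<in> carrier R. enat a \<le> v1 f \<and> enat b \<le> v2 f}"

lemma E_imp_multiple:
  "(a, b) \<in> plane.E \<Longrightarrow> \<exists>g\<in>carrier R. v1 (x \<otimes> g) = enat a \<and> v2 (x \<otimes> g) = enat b"
proof -
  assume "(a, b) \<in> plane.E"
  then obtain g where "g \<in> carrier R" "p \<le> a" "q \<le> b" "v1 g = enat (a - p)" "v2 g = enat (b - q)"
    unfolding plane.E_iff unfolding vals_def by auto
  then show ?thesis
    using x v1.v_mult[of x g] v2.v_mult[of x g] by auto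
qed

lemma step_right:
  assumes "f \<in> Fil a b" "\<not> plane.jump_right a b"
  shows "\<exists>r\<in>carrier R. f \<ominus> x \<otimes> r \<in> Fil (Suc a) b"
proof -
  have "\<exists>g\<in>carrier R. v1 (x \<otimes> g) = enat a \<and> enat b \<le> v2 (x \<otimes> g)"
    if y: "b \<le> y" "(a, y) \<in> vals" for y
  proof -
    obtain z where "b \<le> z" "(a, z) \<in> plane.E"
      using assms(2) y by (auto simp: plane.jump_right_def ray_up_def)
    then show ?thesis
      using E_imp_multiple by fastforce
  qed
  then show ?thesis
    using step[of x f a b] assms x by (auto simp: Fil_def)
qed

lemma step_up:
  assumes "f \<in> Fil a b" "\<not> plane.jump_up a b"
  shows "\<exists>r\<in>carrier R. f \<ominus> x \<otimes> r \<in> Fil a (Suc b)"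
proof -
  have "\<exists>g\<in>carrier R. v2 (x \<otimes> g) = enat b \<and> enat a \<le> v1 (x \<otimes> g)"
    if y: "a \<le> y" "(y, b) \<in> vals" for y
  proof -
    obtain z where "a \<le> z" "(z, b) \<in> plane.E"
      using assms(2) y by (auto simp: plane.jump_up_def ray_right_def)
    then show ?thesis
      using E_imp_multiple by fastforce
  qed
  then show ?thesis
    using two_valued_ring.step[OF swap, of x f b a] assms x by (auto simp: Fil_def vals_swap)
qed

lemma combine_multiples:
  assumes "f \<in> carrier R" "r \<in> carrier R" "s \<in> carrier R"
  shows "f \<ominus> x \<otimes> r \<ominus> x \<otimes> s = f \<ominus> x \<otimes> (r \<oplus> s)"
  using assms x by (simp add: a_minus_def r_distr minus_add a_assoc)

lemma no_jump_right:
  assumes "a \<le> a'" "plane.d a' b = plane.d a b" "f \<in> Fil a b"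
  shows "\<exists>r\<in>carrier R. f \<ominus> x \<otimes> r \<in> Fil a' b"
  using assms(1,2)
proof (induction a' rule: dec_induct)
  case base
  then show ?case
    using assms x by (intro bexI[of _ \<zero>]) (auto simp: a_minus_def Fil_def)
next
  case (step n)
  have "plane.d n b = plane.d a b" "\<not> plane.jump_right n b"
    using step.prems step.hyps plane.d_mono[of a n b b] plane.d_right[of n b] by auto
  with step.IH obtain r where r: "r \<in> carrier R" "f \<ominus> x \<otimes> r \<in> Fil n b" by blast
  with \<open>\<not> plane.jump_right n b\<close> obtain s where
    "s \<in> carrier R" "f \<ominus> x \<otimes> r \<ominus> x \<otimes> s \<in> Fil (Suc n) b"
    using step_right by blast
  then show ?case
    using combine_multiples[of f r s] r assms(3) by (auto simp: Fil_def intro!: bexI[of _ "r \<oplus> s"])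
qed

lemma no_jump_up:
  assumes "b \<le> b'" "plane.d a b' = plane.d a b" "f \<in> Fil a b"
  shows "\<exists>r\<in>carrier R. f \<ominus> x \<otimes> r \<in> Fil a b'"
  using assms(1,2)
proof (induction b' rule: dec_induct)
  case base
  then show ?case
    using assms x by (intro bexI[of _ \<zero>]) (auto simp: a_minus_def Fil_def)
next
  case (step n)
  have "plane.d a n = plane.d a b" "\<not> plane.jump_up a n"
    using step.prems step.hyps plane.d_mono[of a a b n] plane.d_up[of a n] by auto
  with step.IH obtain r where r: "r \<in> carrier R" "f \<ominus> x \<otimes> r \<in> Fil a n" by blast
  with \<open>\<not> plane.jump_up a n\<close> obtain s where
    "s \<in> carrier R" "f \<ominus> x \<otimes> r \<ominus> x \<otimes> s \<in> Fil a (Suc n)"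
    using step_up by blast
  then show ?case
    using combine_multiples[of f r s] r assms(3) by (auto simp: Fil_def intro!: bexI[of _ "r \<oplus> s"])
qed

text \<open>\<open>d\<close> is monotone, so equality at the two ends makes it constant on the path
  to the right and then up, and no step of that path is a jump.\<close>

lemma no_jump:
  assumes "a \<le> a'" "b \<le> b'" "plane.d a' b' = plane.d a b" "f \<in> Fil a b"
  shows "\<exists>r\<in>carrier R. f \<ominus> x \<otimes> r \<in> Fil a' b'"
proof -
  have d: "plane.d a' b = plane.d a b"
    using plane.d_mono[of a a' b b] plane.d_mono[of a' a' b b'] assms by simp
  obtain r where r: "r \<in> carrier R" "f \<ominus> x \<otimes> r \<in> Fil a' b"
    using no_jump_right[OF assms(1) d assms(4)] by blast
  obtain s where "s \<in> carrier R" "f \<ominus> x \<otimes> r \<ominus> x \<otimes> s \<in> Fil a' b'"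
    using no_jump_up[OF assms(2) _ r(2)] d assms(3) by auto
  then show ?thesis
    using combine_multiples[of f r s] r assms(4) by (auto simp: Fil_def intro!: bexI[of _ "r \<oplus> s"])
qed

text \<open>\<open>d\<close> has reached its maximum, so \<open>f\<close> can be moved arbitrarily
  far out modulo \<open>x\<close>, up to where \<open>divide\<close> applies.\<close>

lemma last_level:
  assumes "plane.d a b = p + q" "f \<in> Fil a b"
  shows "\<exists>r\<in>carrier R. f = x \<otimes> r"
proof -
  have "plane.d (a + \<delta>1 + p) (b + \<delta>2 + q) = plane.d a b"
    using plane.d_far[of "a + \<delta>1 + p" "b + \<delta>2 + q"] assms(1) by simp
  then obtain r where r: "r \<in> carrier R" "f \<ominus> x \<otimes> r \<in> Fil (a + \<delta>1 + p) (b + \<delta>2 + q)"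
    using no_jump[of a "a + \<delta>1 + p" b "b + \<delta>2 + q" f] assms by auto
  have "v1 x + enat \<delta>1 \<le> enat (a + \<delta>1 + p)" "v2 x + enat \<delta>2 \<le> enat (b + \<delta>2 + q)"
    using x by simp_all
  with r have "v1 x + enat \<delta>1 \<le> v1 (f \<ominus> x \<otimes> r)" "v2 x + enat \<delta>2 \<le> v2 (f \<ominus> x \<otimes> r)"
    unfolding Fil_def by (blast intro: order_trans)+
  then obtain s where s: "s \<in> carrier R" "f \<ominus> x \<otimes> r = x \<otimes> s"
    using divide[of x "f \<ominus> x \<otimes> r"] r x by (auto simp: Fil_def)
  have "f = (f \<ominus> x \<otimes> r) \<oplus> x \<otimes> r"
    using assms r x by (simp add: Fil_def a_minus_def a_assoc l_neg)
  also have "\<dots> = x \<otimes> (s \<oplus> r)"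
    using s r x by (simp add: r_distr)
  finally show ?thesis
    using s r by blast
qed

text \<open>Since the value of \<open>h\<close> is exactly \<open>(a, b)\<close>, a multiple of it
  can raise the first value of \<open>f\<close> without lowering the second below \<open>b\<close>.
  The same \<open>h\<close> serves for \<open>absorb_up\<close>.\<close>

lemma absorb_right:
  assumes "h \<in> carrier R" "v1 h = enat a" "v2 h = enat b" "f \<in> Fil a b"
  shows "\<exists>c\<in>K. f \<ominus> c \<otimes> h \<in> Fil (Suc a) b"
proof -
  obtain c where c: "c \<in> K" "enat a < v1 (f \<ominus> c \<otimes> h)"
    using residue1[of f h] assms by (auto simp: Fil_def)
  then have "c \<in> carrier R" using K_subset by auto
  then have "enat b \<le> v2 (c \<otimes> h)"
    using v2.v_mult[of c h] assms by (cases "v2 c") auto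
  then have "enat b \<le> v2 (f \<ominus> c \<otimes> h)"
    using v2.v_minus_ge[of f "c \<otimes> h"] assms \<open>c \<in> carrier R\<close> by (simp add: Fil_def)
  then show ?thesis
    using c assms \<open>c \<in> carrier R\<close> by (auto simp: Fil_def Suc_ile_eq)
qed

lemma swap_elem: "two_valued_ring_elem R v2 v1 K \<delta>2 \<delta>1 x q p"
  using swap x by (simp add: two_valued_ring_elem_def two_valued_ring_elem_axioms_def)

lemma absorb_up:
  assumes "h \<in> carrier R" "v1 h = enat a" "v2 h = enat b" "f \<in> Fil a b"
  shows "\<exists>c\<in>K. f \<ominus> c \<otimes> h \<in> Fil a (Suc b)"
  using two_valued_ring_elem.absorb_right[OF swap_elem, of h b a f] assms
  unfolding Fil_def two_valued_ring_elem.Fil_def[OF swap_elem] by auto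

text \<open>\<open>L\<close> says that a further chain element \<open>\<beta>\<close> follows. Then
  the direction is the one recorded by \<open>jump_step\<close>, which keeps the new corner below
  \<open>\<beta>\<close>; at the end of the chain any jump from \<open>Ap_jump\<close> will
  do.\<close>

lemma absorb:
  assumes h: "h \<in> carrier R" "v1 h = enat (fst \<alpha>)" "v2 h = enat (snd \<alpha>)"
    and f: "f \<in> Fil (fst \<alpha>) (snd \<alpha>)" and "\<alpha> \<in> plane.Ap"
    and L: "L \<Longrightarrow> plane.jump_step \<alpha> \<beta>"
  shows "\<exists>c\<in>K. \<exists>a b. f \<ominus> c \<otimes> h \<in> Fil a b \<and> plane.d a b = Suc (plane.d (fst \<alpha>) (snd \<alpha>))
          \<and> (L \<longrightarrow> (a, b) \<le> \<beta>)"
proof -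
  define a b where "a = fst \<alpha>" and "b = snd \<alpha>"
  consider "plane.jump_right a b" "L \<longrightarrow> (Suc a, b) \<le> \<beta>"
    | "plane.jump_up a b" "L \<longrightarrow> (a, Suc b) \<le> \<beta>"
    using plane.Ap_jump[of a b] assms(5) L unfolding plane.jump_step_def a_def b_def
    by auto
  then show ?thesis
  proof cases
    case 1
    then show ?thesis
      using absorb_right[OF h f] plane.d_right[of a b] unfolding a_def b_def by force
  next
    case 2
    then show ?thesis
      using absorb_up[OF h f] plane.d_up[of a b] unfolding a_def b_def by force
  qed
qed

text \<open>Downward induction on \<open>k\<close>. As \<open>(a, b)\<close> and
  \<open>\<alpha> k\<close> have the same \<open>d\<close>, \<open>f\<close> moves up to
  \<open>\<alpha> k\<close> modulo \<open>x\<close>; there a multiple of \<open>h k\<close> is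
  removed, \<open>d\<close> grows by one, and the remainder is spanned by the later
  \<open>h\<close>.\<close>

lemma Fil_subset_Span:
  assumes \<alpha>: "\<And>k. k \<in> {1..p + q} \<Longrightarrow> \<alpha> k \<in> plane.Ap \<and> plane.d (fst (\<alpha> k)) (snd (\<alpha> k)) + 1 = k"
    and steps: "\<And>k. k \<in> {1..<p + q} \<Longrightarrow> plane.jump_step (\<alpha> k) (\<alpha> (Suc k))"
    and h: "\<And>k. k \<in> {1..p + q} \<Longrightarrow>
      h k \<in> carrier R \<and> v1 (h k) = enat (fst (\<alpha> k)) \<and> v2 (h k) = enat (snd (\<alpha> k))"
    and "k \<le> Suc (p + q)" "1 \<le> k" "f \<in> Fil a b" "plane.d a b + 1 = k"
    and "k \<le> p + q \<Longrightarrow> (a, b) \<le> \<alpha> k"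
  shows "PIdl x +> f \<in> ring.Span (R Quot (PIdl x)) ((\<lambda>c. PIdl x +> c) ` K)
           (map (\<lambda>i. PIdl x +> h i) [k..<Suc (p + q)])"
proof -
  define I where "I = PIdl x"
  interpret I: ideal I R
    unfolding I_def by (rule cgenideal_ideal[OF x(1)])
  interpret quot: ring "R Quot I"
    by (rule I.quotient_is_ring)
  interpret hom: ring_hom_ring R "R Quot I" "(+>) I"
    by (rule I.rcos_ring_hom_ring)
  have multiple: "I +> x \<otimes> r = \<zero>\<^bsub>R Quot I\<^esub>" if "r \<in> carrier R" for r
  proof -
    have "x \<otimes> r \<in> I"
      using that x unfolding I_def cgenideal_def by (auto simp: m_comm)
    then show ?thesis
      unfolding zero_FactRing by (rule I.a_rcos_const)
  qed
  have minus_multiple: "I +> (f \<ominus> x \<otimes> r) = I +> f" if "f \<in> carrier R" "r \<in> carrier R" for f r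
    using that multiple[of r] x hom.hom_add[of f "\<ominus> (x \<otimes> r)"] by (simp add: a_minus_def)
  have "I +> f \<in> quot.Span ((+>) I ` K) (map (\<lambda>i. I +> h i) [k..<Suc (p + q)])"
    using assms(4-8)
  proof (induction k arbitrary: a b f rule: inc_induct)
    \<comment> \<open>Here \<open>k = p + q + 1\<close>: no generator is left, and
      \<open>d a b = p + q\<close> forces \<open>f\<close> into \<open>xR\<close>.\<close>
    case base
    then obtain r where "r \<in> carrier R" "f = x \<otimes> r"
      using last_level[of a b f] by auto
    then show ?case using multiple by simp
  next
    case (step k)
    then have k: "k \<in> {1..p + q}" by simp
    obtain a' b' where ab': "\<alpha> k = (a', b')" by fastforce
    then obtain r where r: "r \<in> carrier R" "f \<ominus> x \<otimes> r \<in> Fil a' b'"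
      using no_jump[of a a' b b' f] \<alpha>[OF k] step.prems k by auto
    have "Suc k \<le> p + q \<Longrightarrow> plane.jump_step (\<alpha> k) (\<alpha> (Suc k))"
      using steps[of k] k by simp
    then obtain c a'' b'' where c: "c \<in> K" "f \<ominus> x \<otimes> r \<ominus> c \<otimes> h k \<in> Fil a'' b''"
      "plane.d a'' b'' + 1 = Suc k" "Suc k \<le> p + q \<longrightarrow> (a'', b'') \<le> \<alpha> (Suc k)"
      using absorb[of "h k" "\<alpha> k" "f \<ominus> x \<otimes> r" "Suc k \<le> p + q" "\<alpha> (Suc k)"]
        h[OF k] \<alpha>[OF k] r ab' by auto
    define g where "g = f \<ominus> x \<otimes> r \<ominus> c \<otimes> h k"
    have carr: "f \<in> carrier R" "c \<in> carrier R" "h k \<in> carrier R" "g \<in> carrier R"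
      using step.prems c K_subset h[OF k] by (auto simp: Fil_def g_def)
    have g: "I +> g \<in> quot.Span ((+>) I ` K) (map (\<lambda>i. I +> h i) [Suc k..<Suc (p + q)])"
      using step.IH[of g a'' b''] c k by (auto simp: g_def)
    have "u = w \<oplus> (u \<ominus> w)" if "u \<in> carrier R" "w \<in> carrier R" for u w
      using that by (simp add: a_minus_def a_lcomm r_neg)
    then have "f \<ominus> x \<otimes> r = c \<otimes> h k \<oplus> g"
      using carr r x unfolding g_def by (simp add: Fil_def)
    then have "I +> f = (I +> c) \<otimes>\<^bsub>R Quot I\<^esub> (I +> h k) \<oplus>\<^bsub>R Quot I\<^esub> (I +> g)"
      using minus_multiple[of f r] carr r by simp
    then have "I +> f \<in> quot.line_extension ((+>) I ` K) (I +> h k)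
        (quot.Span ((+>) I ` K) (map (\<lambda>i. I +> h i) [Suc k..<Suc (p + q)]))"
      unfolding quot.line_extension_mem_iff using g c(1) by blast
    moreover have "[k..<Suc (p + q)] = k # [Suc k..<Suc (p + q)]"
      using k by (intro upt_conv_Cons) simp
    ultimately show ?case
      by (simp del: upt_Suc)
  qed
  then show ?thesis
    by (simp add: I_def)
qed

theorem exists_spanning_chain:
  assumes min: "min_vec vals = (p, q)"
  shows "\<exists>\<alpha> :: nat \<Rightarrow> nat \<times> nat.
    (\<forall>i\<in>{1..p + q}. \<alpha> i \<in> vals \<and> \<alpha> i \<in> apery_level vals i) \<and>
    (\<forall>i\<in>{1..<p + q}. \<alpha> i < \<alpha> (Suc i)) \<and>
    (\<forall>h. (\<forall>i\<in>{1..p + q}. h i \<in> carrier R \<and> v1 (h i) = enat (fst (\<alpha> i)) \<and> v2 (h i) = enat (snd (\<alpha> i))) \<longrightarrow>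
      carrier (R Quot (PIdl x)) =
        ring.Span (R Quot (PIdl x)) ((\<lambda>c. PIdl x +> c) ` K)
          (map (\<lambda>i. PIdl x +> h i) [1..<Suc (p + q)]))"
proof -
  obtain \<alpha> where \<alpha>: "\<And>k. k \<in> {1..p + q} \<Longrightarrow> \<alpha> k \<in> plane.Ap \<and> plane.d (fst (\<alpha> k)) (snd (\<alpha> k)) + 1 = k"
    and steps: "\<And>k. k \<in> {1..<p + q} \<Longrightarrow> plane.jump_step (\<alpha> k) (\<alpha> (Suc k))"
    using plane.exists_jump_chain by blast
  show ?thesis
  proof (intro exI[of _ \<alpha>] conjI ballI allI impI)
    fix i assume i: "i \<in> {1..p + q}"
    show "\<alpha> i \<in> vals"
      using \<alpha>[OF i] by (auto simp: plane.Ap_def)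
    show "\<alpha> i \<in> apery_level vals i"
      using \<alpha>[OF i] by (subst plane.apery_level_eq[OF min i]) auto
  next
    fix i assume "i \<in> {1..<p + q}"
    then show "\<alpha> i < \<alpha> (Suc i)"
      using steps plane.jump_step_less by blast
  next
    fix h assume "\<forall>i\<in>{1..p + q}. h i \<in> carrier R \<and> v1 (h i) = enat (fst (\<alpha> i)) \<and> v2 (h i) = enat (snd (\<alpha> i))"
    then have h: "h i \<in> carrier R \<and> v1 (h i) = enat (fst (\<alpha> i)) \<and> v2 (h i) = enat (snd (\<alpha> i))"
      if "i \<in> {1..p + q}" for i
      using that by blast
    let ?I = "PIdl x"
    interpret I: ideal ?I R
      by (rule cgenideal_ideal[OF x(1)])
    interpret quot: ring "R Quot ?I"
      by (rule I.quotient_is_ring)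
    interpret hom: ring_hom_ring R "R Quot ?I" "(+>) ?I"
      by (rule I.rcos_ring_hom_ring)
    show "carrier (R Quot ?I) = quot.Span ((+>) ?I ` K) (map (\<lambda>i. ?I +> h i) [1..<Suc (p + q)])"
    proof
      show "quot.Span ((+>) ?I ` K) (map (\<lambda>i. ?I +> h i) [1..<Suc (p + q)]) \<subseteq> carrier (R Quot ?I)"
        using K_subset h by (intro quot.Span_in_carrier) auto
      show "carrier (R Quot ?I) \<subseteq> quot.Span ((+>) ?I ` K) (map (\<lambda>i. ?I +> h i) [1..<Suc (p + q)])"
      proof
        fix s assume "s \<in> carrier (R Quot ?I)"
        then obtain f where f: "f \<in> carrier R" "s = ?I +> f"
          unfolding carrier_FactRing by blast
        \<comment> \<open>At the origin \<open>d\<close> is 0, so the induction is entered at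
          \<open>k = 1\<close> with the full list of generators.\<close>
        then have F: "f \<in> Fil 0 0"
          by (simp add: Fil_def zero_enat_def[symmetric])
        show "s \<in> quot.Span ((+>) ?I ` K) (map (\<lambda>i. ?I +> h i) [1..<Suc (p + q)])"
          unfolding f(2)
          by (rule Fil_subset_Span[OF \<alpha> steps h, where a=0 and b=0])
            (use F in \<open>auto simp: plane.d_0 less_eq_prod_def\<close>)
      qed
    qed
  qed
qed

end

section \<open>The integral closure\<close>

text \<open>An ideal containing the positive values and some \<open>f\<close> of value 0 contains
  \<open>f \<otimes> g\<close> and \<open>f \<otimes> g \<ominus> \<one>\<close>, hence
  \<open>\<one>\<close>. Inverses are asked only up to positive value, because for \<open>B\<close>
  and \<open>R\<close> they are found in \<open>V\<close> and lifted back approximately.\<close>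

lemma (in valued_ring) positive_maximalideal:
  assumes zero: "v \<zero> = \<infinity>" and one: "v \<one> = 0"
    and inverse: "\<And>f. \<lbrakk>f \<in> carrier R; v f = 0\<rbrakk> \<Longrightarrow> \<exists>g\<in>carrier R. 0 < v (f \<otimes> g \<ominus> \<one>)"
  shows "maximalideal {f \<in> carrier R. 0 < v f} R"
proof -
  let ?n = "{f \<in> carrier R. 0 < v f}"
  show ?thesis
  proof (rule maximalidealI)
    show "ideal ?n R"
    proof (rule idealI[OF ring_axioms])
      show "subgroup ?n (add_monoid R)"
      proof (rule add.subgroupI)
        show "?n \<noteq> {}" using zero by auto
        show "f \<oplus> g \<in> ?n" if "f \<in> ?n" "g \<in> ?n" for f g
          using that v_add[of f g] by (auto simp: min_def split: if_splits)
      qed (auto simp: v_uminus)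
    qed (auto simp: v_mult)
    show "carrier R \<noteq> ?n"
      using one by auto
    fix J assume J: "ideal J R" "?n \<subseteq> J" "J \<subseteq> carrier R"
    interpret J: ideal J R by fact
    show "J = ?n \<or> J = carrier R"
    proof (cases "J \<subseteq> ?n")
      case False
      then obtain f where f: "f \<in> J" "f \<in> carrier R" "v f = 0"
        using J by auto
      then obtain g where g: "g \<in> carrier R" "0 < v (f \<otimes> g \<ominus> \<one>)"
        using inverse by blast
      then have "f \<otimes> g \<ominus> \<one> \<in> J" "f \<otimes> g \<in> J"
        using f J(2) J.I_r_closed[of f g] by (simp_all add: subset_iff)
      then have "f \<otimes> g \<ominus> (f \<otimes> g \<ominus> \<one>) \<in> J"
        by (simp add: a_minus_def)
      also have "f \<otimes> g \<ominus> (f \<otimes> g \<ominus> \<one>) = \<one>"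
        using f g by (simp add: a_minus_def minus_add r_neg2)
      finally show ?thesis
        using J.one_imp_carrier by blast
    qed (use J in auto)
  qed
qed

lemma (in dvr) val_uminus: "f \<in> carrier V \<Longrightarrow> val (\<ominus> f) = val f"
proof -
  have le: "val f \<le> val (\<ominus> f)" if "f \<in> carrier V" for f
    using val_mult[of f "\<ominus> \<one>"] that by (simp add: r_minus)
  then show "f \<in> carrier V \<Longrightarrow> ?thesis"
    using le[of f] le[of "\<ominus> f"] by (intro antisym) auto
qed

lemma (in dvr) valued_ring_pullback:
  assumes "cring R" "ring_hom_ring R V h"
  shows "valued_ring R (\<lambda>f. val (h f))"
proof -
  interpret R: cring R by fact
  interpret h: ring_hom_ring R V h by fact
  show ?thesis
    by unfold_locales (simp_all add: val_mult val_add val_uminus)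
qed

text \<open>The ideal of positive values of \<open>B\<close> is maximal, and so is its trace on \<open>R\<close>, because \<open>R\<close>
  and \<open>B\<close> have the same residue ring.\<close>

lemma (in dvr) residue:
  fixes R B :: "'r ring"
  assumes "cring B" "cring R" and R_eq: "R = B\<lparr>carrier := carrier R\<rparr>" and sub: "carrier R \<subseteq> carrier B"
    and hB: "ring_hom_ring B V h" and hR: "ring_hom_ring R V h"
    and surj: "h ` carrier B = carrier V"
    and rational: "residually_rational R B"
    and local_ring: "{I. maximalideal I R} = {m}"
    and K: "K \<subseteq> carrier R" "(\<lambda>a. m +>\<^bsub>R\<^esub> a) ` K = carrier (R Quot m)"
    and f: "f \<in> carrier R" "g \<in> carrier R" "val (h g) \<noteq> \<infinity>" "val (h g) \<le> val (h f)"
  shows "\<exists>c\<in>K. val (h g) < val (h (f \<ominus>\<^bsub>R\<^esub> c \<otimes>\<^bsub>R\<^esub> g))"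
proof -
  have residues: "(\<lambda>a. n +>\<^bsub>B\<^esub> a) ` carrier R = carrier (B Quot n)" if "maximalideal n B" for n
    using rational that by (simp add: residually_rational_def)
  interpret B: cring B by fact
  interpret R: cring R by fact
  interpret hB: ring_hom_ring B V h by fact
  interpret hR: ring_hom_ring R V h by fact
  interpret vB: valued_ring B "\<lambda>f. val (h f)"
    by (rule valued_ring_pullback) fact+
  interpret vR: valued_ring R "\<lambda>f. val (h f)"
    by (rule valued_ring_pullback) fact+
  have hR_minus: "h (a \<ominus>\<^bsub>R\<^esub> b) = h a \<ominus> h b" if "a \<in> carrier R" "b \<in> carrier R" for a b
    using that by (simp add: a_minus_def)
  have hB_minus: "h (a \<ominus>\<^bsub>B\<^esub> b) = h a \<ominus> h b" if "a \<in> carrier B" "b \<in> carrier B" for a b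
    using that by (simp add: a_minus_def)
  define n where "n = {f \<in> carrier B. 0 < val (h f)}"
  have inverse: "\<exists>b\<in>carrier B. h a \<otimes> h b = \<one>" if a: "a \<in> carrier B" "val (h a) = 0" for a
  proof -
    have "h a \<in> Units V" using val_eq_0_iff a by simp
    then obtain w where "w \<in> carrier V" "h a \<otimes> w = \<one>"
      using Units_inv_closed Units_r_inv by blast
    with surj show ?thesis by (metis (no_types, lifting) image_iff)
  qed
  have n: "maximalideal n B"
    unfolding n_def
  proof (rule vB.positive_maximalideal)
    fix a assume a: "a \<in> carrier B" "val (h a) = 0"
    with inverse obtain b where b: "b \<in> carrier B" "h a \<otimes> h b = \<one>" by blast
    then have "h (a \<otimes>\<^bsub>B\<^esub> b \<ominus>\<^bsub>B\<^esub> \<one>\<^bsub>B\<^esub>) = \<zero>"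
      using a by (simp add: hB_minus a_minus_def r_neg)
    then show "\<exists>b\<in>carrier B. 0 < val (h (a \<otimes>\<^bsub>B\<^esub> b \<ominus>\<^bsub>B\<^esub> \<one>\<^bsub>B\<^esub>))"
      using b by (intro bexI[of _ b]) (simp_all add: val_zero)
  qed (simp_all add: val_zero val_one)
  interpret n: maximalideal n B by (rule n)
  \<comment> \<open>Residual rationality at \<open>n\<close>: the coset of \<open>a\<close> has a
    representative in \<open>R\<close>, and the difference lies in \<open>n\<close>, which means
    positive value.\<close>
  have lift: "\<exists>r\<in>carrier R. 0 < val (h a \<ominus> h r)" if a: "a \<in> carrier B" for a
  proof -
    have "n +>\<^bsub>B\<^esub> a \<in> (\<lambda>a. n +>\<^bsub>B\<^esub> a) ` carrier R"
      unfolding residues[OF n] carrier_FactRing using a by blast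
    then obtain r where r: "r \<in> carrier R" "n +>\<^bsub>B\<^esub> a = n +>\<^bsub>B\<^esub> r" by blast
    then have "a \<in> n +>\<^bsub>B\<^esub> r"
      using n.a_rcos_self[OF a] by simp
    then have "a \<ominus>\<^bsub>B\<^esub> r \<in> n"
      using n.a_rcos_module_minus[OF B.ring_axioms] a r sub by blast
    then have "0 < val (h (a \<ominus>\<^bsub>B\<^esub> r))"
      unfolding n_def by blast
    moreover have "r \<in> carrier B"
      using r(1) sub by blast
    ultimately show ?thesis
      using hB_minus[OF a] r(1) by (intro bexI[of _ r]) simp_all
  qed
  have "maximalideal {f \<in> carrier R. 0 < val (h f)} R"
  proof (rule vR.positive_maximalideal)
    fix a assume a: "a \<in> carrier R" "val (h a) = 0"
    with inverse sub obtain b where b: "b \<in> carrier B" "h a \<otimes> h b = \<one>" by blast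
    obtain r where r: "r \<in> carrier R" "0 < val (h b \<ominus> h r)"
      using lift b by blast
    have "h (a \<otimes>\<^bsub>R\<^esub> r \<ominus>\<^bsub>R\<^esub> \<one>\<^bsub>R\<^esub>) = h a \<otimes> h r \<ominus> \<one>"
      using a r by (simp add: hR_minus)
    also have "\<dots> = \<ominus> (h a \<otimes> (h b \<ominus> h r))"
      using a b(1) r by (simp add: b(2) a_minus_def r_distr minus_add r_minus a_comm)
    finally have "val (h (a \<otimes>\<^bsub>R\<^esub> r \<ominus>\<^bsub>R\<^esub> \<one>\<^bsub>R\<^esub>)) = val (h b \<ominus> h r)"
      using a b r by (simp add: val_uminus val_mult)
    then show "\<exists>r\<in>carrier R. 0 < val (h (a \<otimes>\<^bsub>R\<^esub> r \<ominus>\<^bsub>R\<^esub> \<one>\<^bsub>R\<^esub>))"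
      using r by (intro bexI[of _ r]) simp_all
  qed (simp_all add: val_zero val_one)
  moreover have "maximalideal I R \<longleftrightarrow> I = m" for I
    using local_ring by (metis mem_Collect_eq singleton_iff)
  ultimately have m: "m = {f \<in> carrier R. 0 < val (h f)}" "maximalideal m R"
    by metis+
  interpret m: maximalideal m R by (rule m(2))
  have liftK: "\<exists>c\<in>K. 0 < val (h r \<ominus> h c)" if r: "r \<in> carrier R" for r
  proof -
    have "m +>\<^bsub>R\<^esub> r \<in> (\<lambda>a. m +>\<^bsub>R\<^esub> a) ` K"
      unfolding K(2) carrier_FactRing using r by blast
    then obtain c where c: "c \<in> K" "m +>\<^bsub>R\<^esub> r = m +>\<^bsub>R\<^esub> c" by blast
    then have "r \<in> m +>\<^bsub>R\<^esub> c"
      using m.a_rcos_self[OF r] by simp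
    then have "r \<ominus>\<^bsub>R\<^esub> c \<in> m"
      using m.a_rcos_module_minus[OF R.ring_axioms] r c K by blast
    then have "0 < val (h (r \<ominus>\<^bsub>R\<^esub> c))"
      unfolding m(1) by blast
    moreover have "c \<in> carrier R"
      using c(1) K(1) by blast
    ultimately show ?thesis
      using hR_minus[OF r] c(1) by (intro bexI[of _ c]) simp_all
  qed
  \<comment> \<open>\<open>w\<close> is the quotient of \<open>h f\<close> by \<open>h g\<close>. It
    is lifted to \<open>B\<close>, approximated in \<open>R\<close> by \<open>lift\<close>, then in
    \<open>K\<close> by \<open>liftK\<close>; each approximation has an error of positive
    value.\<close>
  obtain w where w: "w \<in> carrier V" "h f = h g \<otimes> w"
    using val_le_imp_divides[OF _ _ f(4)] f by auto
  then obtain b where b: "b \<in> carrier B" "w = h b" using surj by blast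
  obtain r where r: "r \<in> carrier R" "0 < val (w \<ominus> h r)"
    using lift b by blast
  obtain c where c: "c \<in> K" "c \<in> carrier R" "0 < val (h r \<ominus> h c)"
    using liftK r K by blast
  have "w \<ominus> h c = (w \<ominus> h r) \<oplus> (h r \<ominus> h c)"
    using w r c by (simp add: a_minus_def a_assoc r_neg1)
  then have pos: "0 < val (w \<ominus> h c)"
    using val_add[of "w \<ominus> h r" "h r \<ominus> h c"] w r c by (auto simp: min_def split: if_splits)
  have "h (f \<ominus>\<^bsub>R\<^esub> c \<otimes>\<^bsub>R\<^esub> g) = h g \<otimes> (w \<ominus> h c)"
    using f w c by (simp add: hR_minus) (simp add: a_minus_def r_distr r_minus m_comm)
  then have "val (h (f \<ominus>\<^bsub>R\<^esub> c \<otimes>\<^bsub>R\<^esub> g)) = val (h g) + val (w \<ominus> h c)"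
    using f w c by (simp add: val_mult)
  moreover have "val (h g) < val (h g) + val (w \<ominus> h c)"
    using pos f(3) by (cases "val (h g)"; cases "val (w \<ominus> h c)") (auto simp: zero_enat_def)
  ultimately show ?thesis
    using c(1) by (intro bexI[of _ c]) simp_all
qed

lemma RDirProd_cring:
  assumes "cring R" "cring S"
  shows "cring (RDirProd R S)"
proof -
  interpret R: cring R by fact
  interpret S: cring S by fact
  interpret ring "RDirProd R S"
    by (rule RDirProd_ring) unfold_locales
  show ?thesis
    by unfold_locales (auto simp: RDirProd_def DirProd_def monoid.defs R.m_comm S.m_comm)
qed

lemma RDirProd_simps [simp]:
  "carrier (RDirProd R S) = carrier R \<times> carrier S"
  "x \<otimes>\<^bsub>RDirProd R S\<^esub> y = (fst x \<otimes>\<^bsub>R\<^esub> fst y, snd x \<otimes>\<^bsub>S\<^esub> snd y)"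
  "x \<oplus>\<^bsub>RDirProd R S\<^esub> y = (fst x \<oplus>\<^bsub>R\<^esub> fst y, snd x \<oplus>\<^bsub>S\<^esub> snd y)"
  "\<one>\<^bsub>RDirProd R S\<^esub> = (\<one>\<^bsub>R\<^esub>, \<one>\<^bsub>S\<^esub>)"
  "\<zero>\<^bsub>RDirProd R S\<^esub> = (\<zero>\<^bsub>R\<^esub>, \<zero>\<^bsub>S\<^esub>)"
  by (auto simp: RDirProd_def DirProd_def monoid.defs split: prod.splits)

section \<open>From the integral closure to the two-valued setting\<close>

locale closure_setting = R: cring R + Q: cring Q + V1: dvr V1 + V2: dvr V2
  for R :: "'a ring" and Q :: "'a ring" and V1 :: "'b ring" and V2 :: "'c ring" +
  fixes \<phi> :: "'a \<Rightarrow> 'b \<times> 'c"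
  assumes fractions: "total_ring_of_fractions Q R"
    and nontrivial: "\<one>\<^bsub>R\<^esub> \<noteq> \<zero>\<^bsub>R\<^esub>"
    and closure_product: "\<phi> \<in> ring_iso (integral_closure R Q) (RDirProd V1 V2)"
    and closure_finite: "finite_ring_extension R (integral_closure R Q)"
begin

abbreviation B :: "'a ring" where
  "B \<equiv> integral_closure R Q"

abbreviation P :: "('b \<times> 'c) ring" where
  "P \<equiv> RDirProd V1 V2"

lemma R_eq: "R = Q\<lparr>carrier := carrier R\<rparr>"
  using fractions by (simp add: total_ring_of_fractions_def)

lemma R_simps [simp]:
  "monoid.mult R = monoid.mult Q" "add R = add Q" "\<one>\<^bsub>R\<^esub> = \<one>\<^bsub>Q\<^esub>" "\<zero>\<^bsub>R\<^esub> = \<zero>\<^bsub>Q\<^esub>"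
  by (subst R_eq, simp)+

lemma B_simps [simp]:
  "monoid.mult B = monoid.mult Q" "add B = add Q" "\<one>\<^bsub>B\<^esub> = \<one>\<^bsub>Q\<^esub>" "\<zero>\<^bsub>B\<^esub> = \<zero>\<^bsub>Q\<^esub>"
  by (simp_all add: integral_closure_def)

lemma B_eq: "B = Q\<lparr>carrier := carrier B\<rparr>"
  by (simp add: integral_closure_def)

lemma B_subset: "carrier B \<subseteq> carrier Q"
  by (auto simp: integral_closure_def)

lemma subring_R: "subring (carrier R) Q"
  using fractions by (simp add: total_ring_of_fractions_def subcring_def)

lemma R_subset: "carrier R \<subseteq> carrier Q"
  using subringE(1)[OF subring_R] .

text \<open>\<open>r\<close> is a root of the monic polynomial X - r; \<open>nontrivial\<close> is
  what makes its leading coefficient nonzero.\<close>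

lemma R_subset_B: "carrier R \<subseteq> carrier B"
proof
  fix r assume r: "r \<in> carrier R"
  then have rQ: "r \<in> carrier Q" using R_subset by blast
  have "polynomial\<^bsub>Q\<^esub> (carrier R) [\<one>\<^bsub>Q\<^esub>, \<ominus>\<^bsub>Q\<^esub> r]"
    using subringE(3,5)[OF subring_R] r nontrivial by (auto simp: polynomial_def)
  moreover have "Q.eval [\<one>\<^bsub>Q\<^esub>, \<ominus>\<^bsub>Q\<^esub> r] r = \<zero>\<^bsub>Q\<^esub>"
    using rQ by (simp add: Q.r_neg)
  ultimately show "r \<in> carrier B"
    using rQ by (auto simp: integral_closure_def intro!: exI[of _ "[\<one>\<^bsub>Q\<^esub>, \<ominus>\<^bsub>Q\<^esub> r]"])
qed

lemma nzd_Units: "d \<in> nonzerodivisors R \<Longrightarrow> d \<in> Units Q"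
  using fractions by (auto simp: total_ring_of_fractions_def)

lemma nzd_carrier: "d \<in> nonzerodivisors R \<Longrightarrow> d \<in> carrier R"
  by (simp add: nonzerodivisors_def)

lemma nzd_mult:
  assumes "c \<in> nonzerodivisors R" "d \<in> nonzerodivisors R"
  shows "c \<otimes>\<^bsub>Q\<^esub> d \<in> nonzerodivisors R"
  unfolding nonzerodivisors_def
proof (intro CollectI conjI ballI impI)
  show "c \<otimes>\<^bsub>Q\<^esub> d \<in> carrier R"
    using R.m_closed[of c d] assms nzd_carrier by simp
  fix g assume g: "g \<in> carrier R" "c \<otimes>\<^bsub>Q\<^esub> d \<otimes>\<^bsub>R\<^esub> g = \<zero>\<^bsub>R\<^esub>"
  then have "c \<otimes>\<^bsub>R\<^esub> (d \<otimes>\<^bsub>R\<^esub> g) = \<zero>\<^bsub>R\<^esub>"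
    using R.m_assoc[of c d g] assms nzd_carrier by simp
  then show "g = \<zero>\<^bsub>R\<^esub>"
    using assms g R.m_closed[of d g] by (auto simp: nonzerodivisors_def)
qed

lemma nzd_cancel:
  "\<lbrakk>d \<in> nonzerodivisors R; a \<in> carrier Q; b \<in> carrier Q; d \<otimes>\<^bsub>Q\<^esub> a = d \<otimes>\<^bsub>Q\<^esub> b\<rbrakk> \<Longrightarrow> a = b"
  using Q.Units_l_cancel nzd_Units by blast

lemma denominator:
  assumes "a \<in> carrier Q"
  obtains d where "d \<in> nonzerodivisors R" "d \<otimes>\<^bsub>Q\<^esub> a \<in> carrier R"
proof -
  obtain r d where rd: "a = r \<otimes>\<^bsub>Q\<^esub> inv\<^bsub>Q\<^esub> d" "r \<in> carrier R" "d \<in> nonzerodivisors R"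
    using fractions assms unfolding total_ring_of_fractions_def by blast
  have "d \<otimes>\<^bsub>Q\<^esub> a = r"
  proof -
    have "d \<in> Units Q" "r \<in> carrier Q" using rd nzd_Units R_subset by auto
    then show ?thesis
      unfolding rd(1) using Q.m_lcomm[of d r "inv\<^bsub>Q\<^esub> d"] Q.Units_closed[of d] by simp
  qed
  with rd(2,3) show thesis by (intro that[of d]) simp_all
qed

lemma denominator_list:
  assumes "set as \<subseteq> carrier Q"
  shows "\<exists>d\<in>nonzerodivisors R. \<forall>a\<in>set as. d \<otimes>\<^bsub>Q\<^esub> a \<in> carrier R"
  using assms
proof (induction as)
  case Nil
  have "\<one>\<^bsub>R\<^esub> \<in> nonzerodivisors R"
    by (auto simp: nonzerodivisors_def simp del: R_simps)
  then show ?case by auto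
next
  case (Cons a as)
  then obtain d where d: "d \<in> nonzerodivisors R" "\<forall>a\<in>set as. d \<otimes>\<^bsub>Q\<^esub> a \<in> carrier R" by auto
  obtain c where c: "c \<in> nonzerodivisors R" "c \<otimes>\<^bsub>Q\<^esub> a \<in> carrier R"
    using denominator Cons.prems by auto
  have cd: "c \<in> carrier R" "d \<in> carrier R" "c \<in> carrier Q" "d \<in> carrier Q"
    using c d nzd_carrier R_subset by auto
  have "c \<otimes>\<^bsub>Q\<^esub> d \<otimes>\<^bsub>Q\<^esub> a = d \<otimes>\<^bsub>Q\<^esub> (c \<otimes>\<^bsub>Q\<^esub> a)"
    using cd Cons.prems by (simp add: Q.m_ac)
  moreover have "c \<otimes>\<^bsub>Q\<^esub> d \<otimes>\<^bsub>Q\<^esub> b = c \<otimes>\<^bsub>Q\<^esub> (d \<otimes>\<^bsub>Q\<^esub> b)" if "b \<in> set as" for b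
    using cd Cons.prems that by (auto simp: Q.m_assoc)
  ultimately have "\<forall>b\<in>set (a # as). c \<otimes>\<^bsub>Q\<^esub> d \<otimes>\<^bsub>Q\<^esub> b \<in> carrier R"
    using cd c(2) d(2) R.m_closed by auto
  then show ?case
    using nzd_mult[OF c(1) d(1)] by blast
qed

lemma \<phi>_closed: "b \<in> carrier B \<Longrightarrow> \<phi> b \<in> carrier P"
  and \<phi>_mult: "\<lbrakk>a \<in> carrier B; b \<in> carrier B\<rbrakk> \<Longrightarrow> \<phi> (a \<otimes>\<^bsub>Q\<^esub> b) = \<phi> a \<otimes>\<^bsub>P\<^esub> \<phi> b"
  and \<phi>_add: "\<lbrakk>a \<in> carrier B; b \<in> carrier B\<rbrakk> \<Longrightarrow> \<phi> (a \<oplus>\<^bsub>Q\<^esub> b) = \<phi> a \<oplus>\<^bsub>P\<^esub> \<phi> b"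
  and \<phi>_one: "\<phi> \<one>\<^bsub>Q\<^esub> = \<one>\<^bsub>P\<^esub>"
  using ring_iso_memE(1-4)[OF closure_product] by (simp_all del: RDirProd_simps)

lemma \<phi>_inj: "\<lbrakk>a \<in> carrier B; b \<in> carrier B; \<phi> a = \<phi> b\<rbrakk> \<Longrightarrow> a = b"
  using ring_iso_memE(5)[OF closure_product] by (auto simp: bij_betw_def inj_on_def)

lemma \<phi>_surj: "y \<in> carrier P \<Longrightarrow> \<exists>b\<in>carrier B. \<phi> b = y"
  using ring_iso_memE(5)[OF closure_product] unfolding bij_betw_def by (metis imageE)

sublocale P: cring P
  by (intro RDirProd_cring) unfold_locales

text \<open>Closure of \<open>B\<close> under multiplication and addition: the preimage under \<open>\<phi>\<close> of the product
  (sum) agrees with the product (sum) after multiplication by a common denominator, where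
  everything lies in \<open>R\<close>.\<close>

lemma B_closed:
  assumes a: "a \<in> carrier B" and b: "b \<in> carrier B"
  shows "a \<otimes>\<^bsub>Q\<^esub> b \<in> carrier B" "a \<oplus>\<^bsub>Q\<^esub> b \<in> carrier B"
proof -
  have Q: "a \<in> carrier Q" "b \<in> carrier Q" using a b B_subset by auto
  have P: "\<phi> a \<in> carrier P" "\<phi> b \<in> carrier P" using a b \<phi>_closed by blast+
  have RB: "r \<in> carrier B" if "r \<in> carrier R" for r using that R_subset_B by blast
  show "a \<otimes>\<^bsub>Q\<^esub> b \<in> carrier B"
  proof -
    obtain u where u: "u \<in> carrier B" "\<phi> u = \<phi> a \<otimes>\<^bsub>P\<^esub> \<phi> b"
      using \<phi>_surj P.m_closed[OF P] by blast
    have uQ: "u \<in> carrier Q" using u B_subset by auto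
    obtain d where d: "d \<in> nonzerodivisors R"
      "d \<otimes>\<^bsub>Q\<^esub> a \<in> carrier R" "d \<otimes>\<^bsub>Q\<^esub> b \<in> carrier R" "d \<otimes>\<^bsub>Q\<^esub> u \<in> carrier R"
      using denominator_list[of "[a, b, u]"] Q uQ by auto
    have dc: "d \<in> carrier R" "d \<in> carrier B" "d \<in> carrier Q" "\<phi> d \<in> carrier P"
      using d nzd_carrier RB R_subset \<phi>_closed by blast+
    have "\<phi> (d \<otimes>\<^bsub>Q\<^esub> (d \<otimes>\<^bsub>Q\<^esub> u)) = \<phi> ((d \<otimes>\<^bsub>Q\<^esub> a) \<otimes>\<^bsub>Q\<^esub> (d \<otimes>\<^bsub>Q\<^esub> b))"
      using a b u(1) d dc P by (simp add: \<phi>_mult u(2) RB P.m_ac del: RDirProd_simps)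
    then have "d \<otimes>\<^bsub>Q\<^esub> (d \<otimes>\<^bsub>Q\<^esub> u) = (d \<otimes>\<^bsub>Q\<^esub> a) \<otimes>\<^bsub>Q\<^esub> (d \<otimes>\<^bsub>Q\<^esub> b)"
      using R.m_closed d dc by (intro \<phi>_inj RB) auto
    also have "\<dots> = d \<otimes>\<^bsub>Q\<^esub> (d \<otimes>\<^bsub>Q\<^esub> (a \<otimes>\<^bsub>Q\<^esub> b))"
      using Q dc by (simp add: Q.m_ac)
    finally have "u = a \<otimes>\<^bsub>Q\<^esub> b"
      using d(1) Q uQ dc by (meson Q.m_closed nzd_cancel)
    with u show ?thesis by simp
  qed
  show "a \<oplus>\<^bsub>Q\<^esub> b \<in> carrier B"
  proof -
    obtain u where u: "u \<in> carrier B" "\<phi> u = \<phi> a \<oplus>\<^bsub>P\<^esub> \<phi> b"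
      using \<phi>_surj P.a_closed[OF P] by blast
    have uQ: "u \<in> carrier Q" using u B_subset by auto
    obtain d where d: "d \<in> nonzerodivisors R"
      "d \<otimes>\<^bsub>Q\<^esub> a \<in> carrier R" "d \<otimes>\<^bsub>Q\<^esub> b \<in> carrier R" "d \<otimes>\<^bsub>Q\<^esub> u \<in> carrier R"
      using denominator_list[of "[a, b, u]"] Q uQ by auto
    have dc: "d \<in> carrier R" "d \<in> carrier B" "d \<in> carrier Q" "\<phi> d \<in> carrier P"
      using d nzd_carrier RB R_subset \<phi>_closed by blast+
    have "\<phi> (d \<otimes>\<^bsub>Q\<^esub> u) = \<phi> ((d \<otimes>\<^bsub>Q\<^esub> a) \<oplus>\<^bsub>Q\<^esub> (d \<otimes>\<^bsub>Q\<^esub> b))"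
      using a b u(1) d dc P by (simp add: \<phi>_mult \<phi>_add u(2) RB P.r_distr del: RDirProd_simps)
    then have "d \<otimes>\<^bsub>Q\<^esub> u = (d \<otimes>\<^bsub>Q\<^esub> a) \<oplus>\<^bsub>Q\<^esub> (d \<otimes>\<^bsub>Q\<^esub> b)"
      using R.a_closed d dc by (intro \<phi>_inj RB) auto
    also have "\<dots> = d \<otimes>\<^bsub>Q\<^esub> (a \<oplus>\<^bsub>Q\<^esub> b)"
      using Q dc by (simp add: Q.r_distr)
    finally have "u = a \<oplus>\<^bsub>Q\<^esub> b"
      using d(1) Q uQ by (meson Q.a_closed nzd_cancel)
    with u show ?thesis by simp
  qed
qed

lemma subring_B: "subring (carrier B) Q"
proof (rule Q.subringI)
  show "\<one>\<^bsub>Q\<^esub> \<in> carrier B"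
    using subringE(3)[OF subring_R] R_subset_B by blast
  fix b assume b: "b \<in> carrier B"
  have "\<ominus>\<^bsub>Q\<^esub> \<one>\<^bsub>Q\<^esub> \<in> carrier B"
    using subringE(3,5)[OF subring_R] R_subset_B by blast
  then have "\<ominus>\<^bsub>Q\<^esub> \<one>\<^bsub>Q\<^esub> \<otimes>\<^bsub>Q\<^esub> b \<in> carrier B"
    using B_closed b by blast
  then show "\<ominus>\<^bsub>Q\<^esub> b \<in> carrier B"
    using b B_subset by (simp add: Q.l_minus subset_iff)
qed (use B_subset B_closed in auto)

sublocale B: cring B
  using Q.subcring_iff[OF B_subset] Q.subcringI'[OF subring_B] B_eq by simp

definition h1 :: "'a \<Rightarrow> 'b" where "h1 b = fst (\<phi> b)"
definition h2 :: "'a \<Rightarrow> 'c" where "h2 b = snd (\<phi> b)"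

lemma hom_B: "ring_hom_ring B V1 h1" "ring_hom_ring B V2 h2"
  using \<phi>_closed \<phi>_mult \<phi>_add \<phi>_one
  by (auto intro!: ring_hom_ringI simp: h1_def h2_def mem_Times_iff
      B.ring_axioms V1.ring_axioms V2.ring_axioms)

lemma hom_R: "ring_hom_ring R V1 h1" "ring_hom_ring R V2 h2"
proof -
  interpret h1: ring_hom_ring B V1 h1 by (rule hom_B)
  interpret h2: ring_hom_ring B V2 h2 by (rule hom_B)
  have *: "r \<in> carrier B" if "r \<in> carrier R" for r
    using that R_subset_B by blast
  show "ring_hom_ring R V1 h1" "ring_hom_ring R V2 h2"
    using h1.hom_mult h1.hom_add h1.hom_one h2.hom_mult h2.hom_add h2.hom_one
    by (auto intro!: ring_hom_ringI simp: * R.ring_axioms V1.ring_axioms V2.ring_axioms)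
qed

sublocale h1: ring_hom_ring B V1 h1 by (rule hom_B)
sublocale h2: ring_hom_ring B V2 h2 by (rule hom_B)

lemma lift_pair: "\<lbrakk>y \<in> carrier V1; z \<in> carrier V2\<rbrakk> \<Longrightarrow> \<exists>b\<in>carrier B. h1 b = y \<and> h2 b = z"
  using \<phi>_surj[of "(y, z)"] by (metis RDirProd_simps(1) SigmaI fst_conv h1_def h2_def snd_conv)

lemma pair_eqI: "\<lbrakk>a \<in> carrier B; b \<in> carrier B; h1 a = h1 b; h2 a = h2 b\<rbrakk> \<Longrightarrow> a = b"
  using \<phi>_inj by (simp add: h1_def h2_def prod_eq_iff)

text \<open>A common denominator of the finitely many module generators of \<open>B\<close>
  multiplies all their \<open>R\<close>-combinations into \<open>R\<close>.\<close>

lemma conductor: "\<exists>d\<in>nonzerodivisors R. \<forall>b\<in>carrier B. d \<otimes>\<^bsub>Q\<^esub> b \<in> carrier R"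
proof -
  obtain bs where bs: "set bs \<subseteq> carrier B" "B.Span (carrier R) bs = carrier B"
    using closure_finite by (auto simp: finite_ring_extension_def)
  obtain d where d: "d \<in> nonzerodivisors R" "\<forall>b\<in>set bs. d \<otimes>\<^bsub>Q\<^esub> b \<in> carrier R"
    using denominator_list[of bs] bs B_subset by blast
  have dc: "d \<in> carrier R" "d \<in> carrier Q"
    using d nzd_carrier R_subset by auto
  have "d \<otimes>\<^bsub>Q\<^esub> b \<in> carrier R" if "b \<in> B.Span (carrier R) cs" "set cs \<subseteq> set bs" for b cs
    using that
  proof (induction cs arbitrary: b)
    case Nil
    then show ?case using dc R.zero_closed by simp
  next
    case (Cons c cs)
    then obtain k v where kv: "k \<in> carrier R" "v \<in> B.Span (carrier R) cs" "b = k \<otimes>\<^bsub>Q\<^esub> c \<oplus>\<^bsub>Q\<^esub> v"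
      by (auto simp: B.line_extension_mem_iff)
    have "v \<in> carrier B"
      using B.Span_in_carrier[OF R_subset_B, of cs] kv Cons.prems bs by auto
    then have carr: "k \<in> carrier Q" "c \<in> carrier Q" "v \<in> carrier Q"
      using kv Cons.prems bs B_subset R_subset by auto
    then have "d \<otimes>\<^bsub>Q\<^esub> b = k \<otimes>\<^bsub>Q\<^esub> (d \<otimes>\<^bsub>Q\<^esub> c) \<oplus>\<^bsub>Q\<^esub> d \<otimes>\<^bsub>Q\<^esub> v"
      using dc by (simp add: kv(3) Q.r_distr Q.m_ac)
    moreover have "d \<otimes>\<^bsub>Q\<^esub> v \<in> carrier R" "d \<otimes>\<^bsub>Q\<^esub> c \<in> carrier R"
      using Cons kv d by auto
    ultimately show ?case
      using R.m_closed[of k "d \<otimes>\<^bsub>Q\<^esub> c"] R.a_closed kv(1) by simp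
  qed
  then show ?thesis
    using d bs by blast
qed

text \<open>If \<open>f\<close> vanishes in one factor, the corresponding idempotent of the product
  lifts to a nonzero element of \<open>B\<close> killed by \<open>f\<close>, although a
  nonzerodivisor is a unit of \<open>Q\<close>. Conversely both factors are domains.\<close>

lemma nzd_iff:
  assumes f: "f \<in> carrier R"
  shows "f \<in> nonzerodivisors R \<longleftrightarrow> h1 f \<noteq> \<zero>\<^bsub>V1\<^esub> \<and> h2 f \<noteq> \<zero>\<^bsub>V2\<^esub>"
proof
  have fB: "f \<in> carrier B" and fQ: "f \<in> carrier Q"
    using f R_subset_B R_subset by auto
  assume nzd: "f \<in> nonzerodivisors R"
  have zero: "g = \<zero>\<^bsub>Q\<^esub>" if "g \<in> carrier B" "h1 f \<otimes>\<^bsub>V1\<^esub> h1 g = \<zero>\<^bsub>V1\<^esub>" "h2 f \<otimes>\<^bsub>V2\<^esub> h2 g = \<zero>\<^bsub>V2\<^esub>" for g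
  proof -
    have gQ: "g \<in> carrier Q" using that B_subset by auto
    have "f \<otimes>\<^bsub>B\<^esub> g = \<zero>\<^bsub>B\<^esub>"
      using that fB h1.hom_mult[of f g] h2.hom_mult[of f g] h1.hom_zero h2.hom_zero B.m_closed[of f g]
      by (intro pair_eqI) (auto simp del: B_simps)
    then have "f \<otimes>\<^bsub>Q\<^esub> g = f \<otimes>\<^bsub>Q\<^esub> \<zero>\<^bsub>Q\<^esub>"
      using fQ by simp
    then show ?thesis
      using nzd_cancel[OF nzd gQ] by simp
  qed
  show "h1 f \<noteq> \<zero>\<^bsub>V1\<^esub> \<and> h2 f \<noteq> \<zero>\<^bsub>V2\<^esub>"
  proof (intro conjI notI)
    assume h: "h1 f = \<zero>\<^bsub>V1\<^esub>"
    obtain g where "g \<in> carrier B" "h1 g = \<one>\<^bsub>V1\<^esub>" "h2 g = \<zero>\<^bsub>V2\<^esub>"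
      using lift_pair by blast
    then show False
      using zero[of g] h fB h1.hom_zero by simp
  next
    assume h: "h2 f = \<zero>\<^bsub>V2\<^esub>"
    obtain g where "g \<in> carrier B" "h1 g = \<zero>\<^bsub>V1\<^esub>" "h2 g = \<one>\<^bsub>V2\<^esub>"
      using lift_pair by blast
    then show False
      using zero[of g] h fB h2.hom_zero by simp
  qed
next
  assume h: "h1 f \<noteq> \<zero>\<^bsub>V1\<^esub> \<and> h2 f \<noteq> \<zero>\<^bsub>V2\<^esub>"
  have "g = \<zero>\<^bsub>R\<^esub>" if g: "g \<in> carrier R" "f \<otimes>\<^bsub>R\<^esub> g = \<zero>\<^bsub>R\<^esub>" for g
  proof -
    have B: "f \<in> carrier B" "g \<in> carrier B" using f g R_subset_B by auto
    have "f \<otimes>\<^bsub>B\<^esub> g = \<zero>\<^bsub>B\<^esub>" using g by simp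
    then have "h1 f \<otimes>\<^bsub>V1\<^esub> h1 g = \<zero>\<^bsub>V1\<^esub>" "h2 f \<otimes>\<^bsub>V2\<^esub> h2 g = \<zero>\<^bsub>V2\<^esub>"
      using B h1.hom_mult[of f g] h2.hom_mult[of f g] h1.hom_zero h2.hom_zero by (simp_all del: B_simps)
    then have "h1 g = \<zero>\<^bsub>V1\<^esub>" "h2 g = \<zero>\<^bsub>V2\<^esub>"
      using h B by (simp_all add: V1.integral_iff V2.integral_iff)
    then have "g = \<zero>\<^bsub>B\<^esub>"
      using B h1.hom_zero h2.hom_zero by (intro pair_eqI) (auto simp del: B_simps)
    then show ?thesis by simp
  qed
  then show "f \<in> nonzerodivisors R"
    using f by (simp add: nonzerodivisors_def del: R_simps)
qed

lemma value_vec_eq: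
  assumes "f \<in> nonzerodivisors R"
  shows "value_vec \<phi> V1 V2 f = (a, b) \<longleftrightarrow> V1.val (h1 f) = enat a \<and> V2.val (h2 f) = enat b"
  using nzd_iff[of f] assms nzd_carrier[of f]
  by (auto simp: value_vec_def V1.val_def V2.val_def h1_def h2_def)

lemma nzd_iff_val:
  assumes "f \<in> carrier R"
  shows "f \<in> nonzerodivisors R \<longleftrightarrow> V1.val (h1 f) \<noteq> \<infinity> \<and> V2.val (h2 f) \<noteq> \<infinity>"
  using nzd_iff[OF assms] by (simp add: V1.val_def V2.val_def)

text \<open>Nonzerodivisors are the elements with two finite values, so this set has the form of
  \<open>vals\<close>.\<close>

lemma value_semigroup_eq:
  "value_semigroup R \<phi> V1 V2
   = {(a, b). \<exists>f\<in>carrier R. V1.val (h1 f) = enat a \<and> V2.val (h2 f) = enat b}"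
proof (intro subset_antisym subrelI)
  fix a b assume "(a, b) \<in> value_semigroup R \<phi> V1 V2"
  then obtain f where "f \<in> nonzerodivisors R" "value_vec \<phi> V1 V2 f = (a, b)"
    unfolding value_semigroup_def by auto
  then show "(a, b) \<in> {(a, b). \<exists>f\<in>carrier R. V1.val (h1 f) = enat a \<and> V2.val (h2 f) = enat b}"
    using nzd_carrier value_vec_eq by blast
next
  fix a b assume "(a, b) \<in> {(a, b). \<exists>f\<in>carrier R. V1.val (h1 f) = enat a \<and> V2.val (h2 f) = enat b}"
  then obtain f where f: "f \<in> carrier R" "V1.val (h1 f) = enat a" "V2.val (h2 f) = enat b"
    by blast
  then have nzd: "f \<in> nonzerodivisors R"
    using nzd_iff_val by simp
  then have "value_vec \<phi> V1 V2 f = (a, b)"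
    using value_vec_eq f by blast
  with nzd show "(a, b) \<in> value_semigroup R \<phi> V1 V2"
    unfolding value_semigroup_def by (metis imageI)
qed

text \<open>\<open>(\<delta>1, \<delta>2)\<close> is the value of an element \<open>d\<close> given
  by \<open>conductor\<close>.\<close>

lemma exists_two_valued_ring:
  assumes local_ring: "{I. maximalideal I R} = {m}"
    and rational: "residually_rational R B"
    and K: "K \<subseteq> carrier R" "(\<lambda>a. m +>\<^bsub>R\<^esub> a) ` K = carrier (R Quot m)"
  shows "\<exists>\<delta>1 \<delta>2. two_valued_ring R (\<lambda>f. V1.val (h1 f)) (\<lambda>f. V2.val (h2 f)) K \<delta>1 \<delta>2"
proof -
  obtain d where d: "d \<in> nonzerodivisors R" "\<forall>b\<in>carrier B. d \<otimes>\<^bsub>Q\<^esub> b \<in> carrier R"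
    using conductor by blast
  have dR: "d \<in> carrier R" and dB: "d \<in> carrier B"
    using d nzd_carrier R_subset_B by auto
  obtain \<delta>1 \<delta>2 where \<delta>: "V1.val (h1 d) = enat \<delta>1" "V2.val (h2 d) = enat \<delta>2"
    using nzd_iff_val[OF dR] d by auto
  have RB: "R = B\<lparr>carrier := carrier R\<rparr>"
    using R_eq by (simp add: integral_closure_def)
  have surj: "h1 ` carrier B = carrier V1" "h2 ` carrier B = carrier V2"
    using lift_pair by (blast intro: h1.hom_closed h2.hom_closed)+
  have "two_valued_ring R (\<lambda>f. V1.val (h1 f)) (\<lambda>f. V2.val (h2 f)) K \<delta>1 \<delta>2"
  proof (intro two_valued_ring.intro two_valued_ring_axioms.intro R.cring_axioms K(1)
      V1.valued_ring_pullback V2.valued_ring_pullback hom_R)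
    fix f h assume "f \<in> carrier R" "h \<in> carrier R"
      "V1.val (h1 h) \<noteq> \<infinity>" "V1.val (h1 h) \<le> V1.val (h1 f)"
    then show "\<exists>c\<in>K. V1.val (h1 h) < V1.val (h1 (f \<ominus>\<^bsub>R\<^esub> c \<otimes>\<^bsub>R\<^esub> h))"
      by (rule V1.residue[OF B.cring_axioms R.cring_axioms RB R_subset_B hom_B(1) hom_R(1) surj(1)
            rational local_ring K])
  next
    fix f h assume "f \<in> carrier R" "h \<in> carrier R"
      "V2.val (h2 h) \<noteq> \<infinity>" "V2.val (h2 h) \<le> V2.val (h2 f)"
    then show "\<exists>c\<in>K. V2.val (h2 h) < V2.val (h2 (f \<ominus>\<^bsub>R\<^esub> c \<otimes>\<^bsub>R\<^esub> h))"
      by (rule V2.residue[OF B.cring_axioms R.cring_axioms RB R_subset_B hom_B(2) hom_R(2) surj(2)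
            rational local_ring K])
  next
    \<comment> \<open>The product decomposition gives an element of \<open>B\<close> with values
      \<open>(a - \<delta>1, b - \<delta>2)\<close>, and \<open>d\<close> brings it into
      \<open>R\<close>.\<close>
    fix a b assume ab: "\<delta>1 \<le> a" "\<delta>2 \<le> b"
    obtain y z where yz: "y \<in> carrier V1" "V1.val y = enat (a - \<delta>1)"
      "z \<in> carrier V2" "V2.val z = enat (b - \<delta>2)"
      using V1.exists_val V2.exists_val by meson
    obtain g where g: "g \<in> carrier B" "h1 g = y" "h2 g = z"
      using lift_pair yz by blast
    have "V1.val (h1 (d \<otimes>\<^bsub>B\<^esub> g)) = enat a" "V2.val (h2 (d \<otimes>\<^bsub>B\<^esub> g)) = enat b"
      using g yz ab dB \<delta> by (simp_all add: V1.val_mult V2.val_mult del: B_simps)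
    then show "\<exists>f\<in>carrier R. V1.val (h1 f) = enat a \<and> V2.val (h2 f) = enat b"
      using d(2) g(1) by auto
  next
    fix x f assume x: "x \<in> carrier R" and f: "f \<in> carrier R"
      and val: "V1.val (h1 x) + enat \<delta>1 \<le> V1.val (h1 f)" "V2.val (h2 x) + enat \<delta>2 \<le> V2.val (h2 f)"
    have B: "x \<in> carrier B" "f \<in> carrier B"
      using x f R_subset_B by auto
    \<comment> \<open>Dividing by \<open>x d\<close> in each factor and gluing the quotients gives
      \<open>g\<close> in \<open>B\<close>; the cofactor of \<open>x\<close> is then
      \<open>d g\<close>, which lies in \<open>R\<close>.\<close>
    have "V1.val (h1 x \<otimes>\<^bsub>V1\<^esub> h1 d) \<le> V1.val (h1 f)" "V2.val (h2 x \<otimes>\<^bsub>V2\<^esub> h2 d) \<le> V2.val (h2 f)"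
      using val \<delta> B dB by (simp_all add: V1.val_mult V2.val_mult)
    then obtain y z where yz: "y \<in> carrier V1" "h1 f = h1 x \<otimes>\<^bsub>V1\<^esub> h1 d \<otimes>\<^bsub>V1\<^esub> y"
      "z \<in> carrier V2" "h2 f = h2 x \<otimes>\<^bsub>V2\<^esub> h2 d \<otimes>\<^bsub>V2\<^esub> z"
      using V1.val_le_imp_divides[of "h1 f" "h1 x \<otimes>\<^bsub>V1\<^esub> h1 d"]
        V2.val_le_imp_divides[of "h2 f" "h2 x \<otimes>\<^bsub>V2\<^esub> h2 d"] B dB by auto
    obtain g where g: "g \<in> carrier B" "h1 g = y" "h2 g = z"
      using lift_pair yz by blast
    have "f = x \<otimes>\<^bsub>B\<^esub> (d \<otimes>\<^bsub>B\<^esub> g)"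
      using g yz B dB by (intro pair_eqI) (simp_all add: V1.m_assoc V2.m_assoc del: B_simps)
    then show "\<exists>g\<in>carrier R. f = x \<otimes>\<^bsub>R\<^esub> g"
      using d(2) g(1) by auto
  qed
  then show ?thesis by blast
qed

end

text \<open>\<open>e\<close> stands for e1 + e2; that the number of levels \<open>apery_N S\<close>
  equals it is proved in \<open>apery_N_eq\<close>. Since \<open>value_vec\<close> is meaningful
  only at nonzerodivisors, membership is stated for \<open>x\<close> and each \<open>f i\<close>.
  The scalars act through the image of \<open>K\<close> in the quotient.\<close>

theorem theorem3p9:
  fixes R Q :: "'a ring" and m K :: "'a set" and x :: 'a
    and V1 :: "'b ring" and V2 :: "'c ring" and \<phi> :: "'a \<Rightarrow> 'b \<times> 'c"
    and S :: "(nat \<times> nat) set" and e :: nat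
  assumes "cring R"
    and noetherian: "noetherian_ring R"
    and local_ring: "{I. maximalideal I R} = {m}"
    and reduced: "reduced_ring R"
    and one_dimensional: "krull_dim R = 1"
    and two_minimal_primes: "card {P. minimal_prime P R} = 2"
    and unramified: "analytically_unramified R m"
    and fractions: "total_ring_of_fractions Q R"
    and dvrs: "discrete_valuation_ring V1" "discrete_valuation_ring V2"
    and closure_product: "\<phi> \<in> ring_iso (integral_closure R Q) (RDirProd V1 V2)"
    and closure_finite: "finite_ring_extension R (integral_closure R Q)"
    and rational: "residually_rational R (integral_closure R Q)"
    and coefficient_field: "subfield K R"
      "bij_betw (\<lambda>a. m +>\<^bsub>R\<^esub> a) K (carrier (R Quot m))"
    and S: "S = value_semigroup R \<phi> V1 V2"
    and e: "e = fst (min_vec S) + snd (min_vec S)"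
    and x: "x \<in> nonzerodivisors R" "value_vec \<phi> V1 V2 x = min_vec S"
  shows "\<exists>\<alpha> :: nat \<Rightarrow> nat \<times> nat.
           (\<forall>i\<in>{1..e}. \<alpha> i \<in> S \<and> \<alpha> i \<in> apery_level S i) \<and>
           (\<forall>i\<in>{1..<e}. \<alpha> i < \<alpha> (Suc i)) \<and>
           (\<forall>f :: nat \<Rightarrow> 'a.
              (\<forall>i\<in>{1..e}. f i \<in> nonzerodivisors R \<and> value_vec \<phi> V1 V2 (f i) = \<alpha> i) \<longrightarrow>
              carrier (R Quot (PIdl\<^bsub>R\<^esub> x)) =
                ring.Span (R Quot (PIdl\<^bsub>R\<^esub> x))
                  ((\<lambda>a. PIdl\<^bsub>R\<^esub> x +>\<^bsub>R\<^esub> a) ` K)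
                  (map (\<lambda>i. PIdl\<^bsub>R\<^esub> x +>\<^bsub>R\<^esub> f i) [1..<Suc e]))"
proof -
  interpret R: cring R by fact
  interpret V1: dvr V1 using dvrs(1) by (rule discrete_valuation_ring_dvr)
  interpret V2: dvr V2 using dvrs(2) by (rule discrete_valuation_ring_dvr)
  interpret Q: cring Q using fractions by (simp add: total_ring_of_fractions_def)
  have "\<one>\<^bsub>R\<^esub> \<noteq> \<zero>\<^bsub>R\<^esub>"
    using subdomainE(10)[OF subfield.axioms(1)[OF coefficient_field(1)]] by simp
  then interpret closure_setting R Q V1 V2 \<phi>
    using fractions closure_product closure_finite by unfold_locales
  have K: "K \<subseteq> carrier R" "(\<lambda>a. m +>\<^bsub>R\<^esub> a) ` K = carrier (R Quot m)"
    using subdomainE(1)[OF subfield.axioms(1)[OF coefficient_field(1)]] coefficient_field(2)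
    by (auto simp: bij_betw_def)
  obtain \<delta>1 \<delta>2 where
    "two_valued_ring R (\<lambda>f. V1.val (h1 f)) (\<lambda>f. V2.val (h2 f)) K \<delta>1 \<delta>2"
    using exists_two_valued_ring[OF local_ring rational K] by blast
  then interpret val: two_valued_ring R "\<lambda>f. V1.val (h1 f)" "\<lambda>f. V2.val (h2 f)" K \<delta>1 \<delta>2 .
  obtain p q where pq: "min_vec S = (p, q)" by fastforce
  interpret val: two_valued_ring_elem R "\<lambda>f. V1.val (h1 f)" "\<lambda>f. V2.val (h2 f)" K \<delta>1 \<delta>2 x p q
    using x value_vec_eq[OF x(1)] pq nzd_carrier by unfold_locales auto
  have vals: "val.vals = S"
    unfolding val.vals_def S value_semigroup_eq ..
  have "p + q = e"
    using pq e by simp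
  note chain = val.exists_spanning_chain[unfolded vals, OF pq, unfolded \<open>p + q = e\<close>]
  from chain show ?thesis
  proof (elim exE conjE)
    fix \<alpha>
    assume \<alpha>: "\<forall>i\<in>{1..e}. \<alpha> i \<in> S \<and> \<alpha> i \<in> apery_level S i" "\<forall>i\<in>{1..<e}. \<alpha> i < \<alpha> (Suc i)"
      and span: "\<forall>f. (\<forall>i\<in>{1..e}. f i \<in> carrier R \<and> V1.val (h1 (f i)) = enat (fst (\<alpha> i))
          \<and> V2.val (h2 (f i)) = enat (snd (\<alpha> i))) \<longrightarrow>
        carrier (R Quot (PIdl\<^bsub>R\<^esub> x)) =
          ring.Span (R Quot (PIdl\<^bsub>R\<^esub> x)) ((\<lambda>a. PIdl\<^bsub>R\<^esub> x +>\<^bsub>R\<^esub> a) ` K)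
            (map (\<lambda>i. PIdl\<^bsub>R\<^esub> x +>\<^bsub>R\<^esub> f i) [1..<Suc e])"
    have vals_f: "f i \<in> carrier R \<and> V1.val (h1 (f i)) = enat (fst (\<alpha> i))
        \<and> V2.val (h2 (f i)) = enat (snd (\<alpha> i))"
      if "f i \<in> nonzerodivisors R" "value_vec \<phi> V1 V2 (f i) = \<alpha> i" for f i
      using that nzd_carrier value_vec_eq[of "f i" "fst (\<alpha> i)" "snd (\<alpha> i)"] by simp
    show ?thesis
      using \<alpha> span vals_f by (intro exI[of _ \<alpha>] conjI allI impI) (assumption+, blast)
  qed
qed

end
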